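(* Let $0\le\beta<\alpha<1$ and $b\in\mathbb{R}$. Let $f:[0,\infty)\times\mathbb{R}^2\to\mathbb{R}$ be such that $f(\cdot,v(\cdot),w(\cdot))\in C[0,\infty)$ for every $v,w\in C[0,\infty)$. Suppose that $$|f(\tau,u,v)|\le\tau^{\gamma}h(\tau)\varphi_1(|u|)\varphi_2(|v|)\quad\text{for all }\tau>0,\ u,v\in\mathbb{R},$$ where $h,\varphi_1,\varphi_2:[0,\infty)\to[0,\infty)$ are continuous, $\varphi_1,\varphi_2$ are nondecreasing, $h\in L_q(0,\infty)$ for some $q>\frac1{\alpha-\beta}$, and $\gamma=\frac1q-\alpha$. Suppose moreover that for some $\xi_0>0$, with $\varphi_1(s^{1/q})\varphi_2(s^{1/q})>0$ for $s\ge\xi_0$, $$\int_{\xi_0}^\infty\frac{ds}{\varphi_1^q(s^{1/q})\,\varphi_2^q(s^{1/q})}=\infty .$$ Then for any solution $x\in C^\alpha[0,\infty)$ of the problem $${}^C\mathfrak{D}_0^\alpha x(\tau)=f\left(\tau,x(\tau),{}^C\mathfrak{D}_0^\beta x(\tau)\right),\quad\tau>0,\qquad x(0)=b,$$ there is a constant $C>0$ such that $$|x(\tau)|\le C\quad\text{and}\quad \left|{}^C\mathfrak{D}_0^\beta x(\tau)\right|<C\quad\text{for all }\tau>0 .$$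
   Context: $AC[0,\infty)$ denotes the functions $x:[0,\infty)\to\mathbb{R}$ that are absolutely continuous on every compact interval $[0,T]$; $C[0,\infty)$ denotes the continuous real functions on $[0,\infty)$. For $\mu>0$ the Riemann-Liouville fractional integral is $\mathfrak{I}_0^\mu g(\tau)=\frac{1}{\Gamma(\mu)}\int_0^\tau (\tau-s)^{\mu-1}g(s)\,ds$, $\tau>0$. For an order $\alpha\in(0,1)$ the Caputo fractional derivative is ${}^C\mathfrak{D}_0^\alpha x(\tau)=\mathfrak{I}_0^{1-\alpha}x'(\tau)$, $\tau>0$ (and likewise for $\beta\in(0,1)$); for order $0$, ${}^C\mathfrak{D}_0^0x=x$. $C^\alpha[0,\infty)=\{x\in AC[0,\infty): {}^C\mathfrak{D}_0^\alpha x\in C[0,\infty)\}$, where membership in $C[0,\infty)$ means continuity on $(0,\infty)$ with a continuous extension to $0$. *)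

theory Defs
  imports "HOL-Analysis.Analysis"
begin

text \<open>
  Absolute continuity on a set of reals, in the usual \<open>\<epsilon>\<close>-\<open>\<delta>\<close> form: \<open>d division_of \<Union>d\<close> says that
  \<open>d\<close> is a finite family of nonempty compact intervals with pairwise disjoint interiors, so that
  \<open>Inf k\<close> and \<open>Sup k\<close> are the end points of \<open>k \<in> d\<close>.
\<close>

definition absolutely_continuous_on :: "real set \<Rightarrow> (real \<Rightarrow> real) \<Rightarrow> bool" where
  "absolutely_continuous_on S f \<longleftrightarrow>
     (\<forall>\<epsilon>>0. \<exists>\<delta>>0. \<forall>d. d division_of \<Union>d \<and> \<Union>d \<subseteq> S \<and> (\<Sum>k\<in>d. Sup k - Inf k) < \<delta>
        \<longrightarrow> (\<Sum>k\<in>d. \<bar>f (Sup k) - f (Inf k)\<bar>) < \<epsilon>)"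

definition AC_halfline :: "(real \<Rightarrow> real) set" where
  "AC_halfline = {x. \<forall>T\<ge>0. absolutely_continuous_on {0..T} x}"

text \<open>
  Functions on the half-line are represented by total functions on the reals whose values at negative
  arguments play no role. The following set is \<open>C[0,\<infinity>)\<close> for functions that are
  given on \<open>(0,\<infinity>)\<close> only: the value at \<open>0\<close> is ignored.
\<close>

definition C_halfline_ext :: "(real \<Rightarrow> real) set" where
  "C_halfline_ext = {g. continuous_on {0<..} g \<and> (\<exists>l. (g \<longlongrightarrow> l) (at_right 0))}"

text \<open>
  The library's Lebesgue integral is \<open>0\<close> for a non-integrable function, so the existence of the
  Riemann-Liouville integral at a point is recorded by a predicate of its own.
\<close>

definition RL_integrable :: "real \<Rightarrow> (real \<Rightarrow> real) \<Rightarrow> real \<Rightarrow> bool" where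
  "RL_integrable \<mu> g \<tau> \<longleftrightarrow> set_integrable lebesgue {0..\<tau>} (\<lambda>s. (\<tau> - s) powr (\<mu> - 1) * g s)"

definition RL_integral :: "real \<Rightarrow> (real \<Rightarrow> real) \<Rightarrow> real \<Rightarrow> real" where
  "RL_integral \<mu> g \<tau> =
     1 / Gamma \<mu> * (LINT s:{0..\<tau>}|lebesgue. (\<tau> - s) powr (\<mu> - 1) * g s)"

text \<open>
  Order \<open>0\<close> is a separate case: the formula for positive orders would give \<open>x \<tau> - x 0\<close>.
  An absolutely continuous \<open>x\<close> is differentiable almost everywhere, so the arbitrary value of
  \<open>deriv x\<close> at the remaining points does not affect the integral.
\<close>

definition caputo :: "real \<Rightarrow> (real \<Rightarrow> real) \<Rightarrow> real \<Rightarrow> real" where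
  "caputo \<alpha> x \<tau> = (if \<alpha> = 0 then x \<tau> else RL_integral (1 - \<alpha>) (deriv x) \<tau>)"

text \<open>
  The space \<open>C\<^sup>\<alpha>[0,\<infinity>)\<close> for \<open>0 < \<alpha> < 1\<close>. That the Caputo derivative is a continuous function on
  \<open>(0,\<infinity>)\<close> includes that its defining integral exists at every \<open>\<tau> > 0\<close>.
\<close>

definition C_frac :: "real \<Rightarrow> (real \<Rightarrow> real) set" where
  "C_frac \<alpha> = {x \<in> AC_halfline.
     (\<forall>\<tau>>0. RL_integrable (1 - \<alpha>) (deriv x) \<tau>) \<and> caputo \<alpha> x \<in> C_halfline_ext}"

text \<open>Hence the Caputo derivatives of lower order of such a function exist as well.\<close>

lemma RL_integrable_lower_order:
  assumes "x \<in> C_frac \<alpha>" "\<beta> < \<alpha>" "\<tau> > 0"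
  shows "RL_integrable (1 - \<beta>) (deriv x) \<tau>"
proof -
  let ?k = "\<lambda>s. indicat_real {0..\<tau>} s *\<^sub>R ((\<tau> - s) powr (1 - \<alpha> - 1) * deriv x s)"
  let ?m = "\<lambda>s. indicat_real {0..\<tau>} s * (\<tau> - s) powr (\<alpha> - \<beta>)"
  have int: "integrable lebesgue ?k"
    using assms by (auto simp: C_frac_def RL_integrable_def set_integrable_def)
  have "?m \<in> borel_measurable borel"
    by measurable
  then have meas: "?m \<in> borel_measurable lebesgue"
    by (simp add: borel_measurable_if_I measurable_completion)
  have eq: "indicat_real {0..\<tau>} s *\<^sub>R ((\<tau> - s) powr (1 - \<beta> - 1) * deriv x s) = ?m s * ?k s" for s
    using assms(2) by (auto simp: indicator_def powr_add[symmetric])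
  have bd: "norm (?m s * ?k s) \<le> norm (\<tau> powr (\<alpha> - \<beta>) * ?k s)" for s
  proof -
    have "\<bar>?m s\<bar> \<le> \<tau> powr (\<alpha> - \<beta>)"
      using assms(2) by (auto simp: indicator_def intro!: powr_mono2)
    then have "\<bar>?m s\<bar> * norm (?k s) \<le> \<bar>\<tau> powr (\<alpha> - \<beta>)\<bar> * norm (?k s)"
      by (intro mult_right_mono) auto
    then show ?thesis
      by (simp only: real_norm_def abs_mult mult.assoc)
  qed
  have "integrable lebesgue (\<lambda>s. ?m s * ?k s)"
  proof (rule Bochner_Integration.integrable_bound)
    show "integrable lebesgue (\<lambda>s. \<tau> powr (\<alpha> - \<beta>) * ?k s)"
      using int by (rule integrable_mult_right)
    show "(\<lambda>s. ?m s * ?k s) \<in> borel_measurable lebesgue"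
      using meas borel_measurable_integrable[OF int] by (rule borel_measurable_times)
    show "AE s in lebesgue. norm (?m s * ?k s) \<le> norm (\<tau> powr (\<alpha> - \<beta>) * ?k s)"
      using bd by (rule AE_I2)
  qed
  then show ?thesis
    by (simp only: RL_integrable_def set_integrable_def eq)
qed

end

theory Submission
  imports Defs
begin

text \<open>
  Write \<open>g\<close> for the Caputo derivative of order \<open>\<alpha>\<close> of the solution \<open>x\<close>. It is continuous on
  \<open>(0,\<infinity>)\<close> with a limit at \<open>0\<close>, and fractional integration undoes fractional differentiation: the
  convolution identity for Riemann-Liouville kernels, which is Fubini's theorem together with the
  Beta integral (\<open>RL_integral_semigroup\<close>), gives \<open>x = b + I\<^sup>\<alpha> g\<close>, and the Caputo derivative of order
  \<open>\<beta> > 0\<close> is \<open>I\<^sup>\<mu> g\<close> with \<open>\<mu> = \<alpha> - \<beta>\<close>. The first identity rests on \<open>x \<tau> - x 0\<close> being the integral of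
  \<open>deriv x\<close>, that is, on Lebesgue's theorem that an absolutely continuous function is differentiable
  almost everywhere and is the integral of its derivative (\<open>AC_FTC\<close>).

  The weight \<open>\<tau> powr \<gamma>\<close> with \<open>\<gamma> = 1/q - \<alpha>\<close> is tuned to Hoelder's inequality. With \<open>p\<close> conjugate to
  \<open>q\<close>, the \<open>p\<close>-norm over \<open>s \<in> [0,\<tau>]\<close> of the kernel \<open>(\<tau> - s) powr (\<mu> - 1) * s powr \<gamma>\<close> is a constant
  times \<open>\<tau> powr (\<mu> - \<alpha>)\<close>: bounded for \<open>\<mu> = \<alpha>\<close>, and equal to a multiple of \<open>\<tau> powr (- \<beta>)\<close>, bounded
  for \<open>\<tau> \<ge> 1\<close>, for \<open>\<mu> = \<alpha> - \<beta>\<close> (\<open>RL_integral_weighted_bound\<close>). On \<open>(0,1]\<close> both functions are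
  bounded because \<open>g\<close> is. Hence \<open>A = max |x| |D\<^sup>\<beta> x|\<close> satisfies
  \<open>A \<tau> \<le> M + K * (\<integral>\<^sub>0\<^sup>\<tau> (h * \<phi>\<^sub>1(w) * \<phi>\<^sub>2(w)) powr q) powr (1/q)\<close> for every nondecreasing
  \<open>w \<ge> A\<close>, in particular for the running supremum of \<open>A\<close>.

  Raising this to the power \<open>q\<close> yields an integral inequality of Bihari's type for a majorant of
  \<open>A powr q\<close> with the nonlinearity \<open>\<Theta> s = (\<phi>\<^sub>1 * \<phi>\<^sub>2) (s powr (1/q)) powr q\<close>. As \<open>h powr q\<close> has
  a finite integral while \<open>1/\<Theta>\<close> has an infinite one, the majorant cannot escape to infinity
  (\<open>Bihari_bounded\<close>, \<open>weighted_growth_bounded\<close>).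
\<close>

section \<open>Increments over divisions and the Vitali covering theorem\<close>

lemma division_interval_nonempty:
  assumes "D division_of S" "K \<in> D"
  obtains u v :: real where "u \<le> v" "K = {u..v}"
  using division_ofD(3,4)[OF assms] by (metis atLeastatMost_empty_iff box_real(2))

text \<open>
  Telescoping, through the additivity of interval functions over divisions. The value on the empty
  set has to be fixed to \<open>0\<close> separately, since \<open>Sup {}\<close> and \<open>Inf {}\<close> need not give a zero increment.
\<close>

lemma sum_increments_division:
  fixes F :: "real \<Rightarrow> real"
  assumes "d division_of {a..b}" "a \<le> b"
  shows "(\<Sum>k\<in>d. F (Sup k) - F (Inf k)) = F b - F a"
proof -
  let ?g = "\<lambda>k::real set. if k = {} then 0 else F (Sup k) - F (Inf k)"
  interpret operative_real plus 0 ?g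
    rewrites "comm_monoid_set.F (+) 0 = sum"
    by standard[1] (auto simp add: sum_def)
  have "(\<Sum>k\<in>d. F (Sup k) - F (Inf k)) = (\<Sum>k\<in>d. ?g k)"
    using division_ofD(3)[OF assms(1)] by (auto intro!: sum.cong)
  also have "\<dots> = ?g {a..b}"
    using division[of d a b] assms by simp
  finally show ?thesis using assms by simp
qed

lemma measure_Union_division:
  assumes "D division_of S"
  shows "measure lebesgue S = (\<Sum>k\<in>D. Sup k - Inf (k::real set))"
proof -
  have "measure lebesgue S = (\<Sum>k\<in>D. measure lebesgue k)"
    using content_division[OF assms] by simp
  also have "\<dots> = (\<Sum>k\<in>D. Sup k - Inf k)"
    by (rule sum.cong) (auto elim!: division_interval_nonempty[OF assms])
  finally show ?thesis .
qed

text \<open>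
  What a family \<open>D'\<close> of intervals leaves of a coarser family \<open>D\<close> is again a family of intervals, and
  increments add up. Instantiating \<open>F\<close> with the identity gives the length of the remainder; the one
  family \<open>R\<close> therefore serves both for lengths and for the increments of a given function, which is
  how absolute continuity gets applied to it.
\<close>

lemma division_remainder:
  fixes D D' :: "real set set"
  assumes D: "D division_of \<Union>D" and D': "D' division_of \<Union>D'"
    and disj: "pairwise disjnt D"
    and sub: "\<And>K. K \<in> D' \<Longrightarrow> \<exists>J\<in>D. K \<subseteq> J"
  obtains R where "R division_of \<Union>R" "\<Union>R \<subseteq> \<Union>D"
    "\<And>F :: real \<Rightarrow> real. (\<Sum>k\<in>R. F (Sup k) - F (Inf k)) =
        (\<Sum>k\<in>D. F (Sup k) - F (Inf k)) - (\<Sum>k\<in>D'. F (Sup k) - F (Inf k))"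
proof -
  \<comment> \<open>\<open>C J\<close> collects the members of \<open>D'\<close> inside \<open>J\<close>, and \<open>q J\<close> completes it to a division of \<open>J\<close>.\<close>
  define C where "C J = {K\<in>D'. K \<subseteq> J}" for J
  have Cdiv: "C J division_of \<Union>(C J)" for J
    using division_of_subset[OF D', of "C J"] by (auto simp: C_def)
  have "\<exists>q. C J \<subseteq> q \<and> q division_of J" if J: "J \<in> D" for J
  proof -
    obtain u v where uv: "J = cbox u v" using division_ofD(4)[OF D J] by blast
    have "\<Union>(C J) \<subseteq> cbox u v" using uv by (auto simp: C_def)
    from partial_division_extend_interval[OF Cdiv this] show ?thesis using uv by metis
  qed
  then obtain q where q: "\<And>J. J \<in> D \<Longrightarrow> C J \<subseteq> q J" "\<And>J. J \<in> D \<Longrightarrow> q J division_of J"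
    by metis
  define R where "R = (\<Union>J\<in>D. q J - C J)"
  note qD = division_ofD[OF q(2)]
  have fin: "finite D" "finite D'" using D D' by auto
  have uniq: "J = J'" if "J \<in> D" "J' \<in> D" "K \<subseteq> J" "K \<subseteq> J'" "K \<noteq> {}" for J J' K
    using disj that unfolding pairwise_def disjnt_def by blast
  have R: "R division_of \<Union>R"
  proof (rule division_ofI)
    show "finite R" unfolding R_def using fin q(2) by auto
    fix K assume K: "K \<in> R"
    then show "K \<subseteq> \<Union>R" "K \<noteq> {}" "\<exists>a b. K = cbox a b"
      using qD(3,4) by (auto simp: R_def)
    fix K' assume K': "K' \<in> R" "K \<noteq> K'"
    obtain J J' where J: "J \<in> D" "K \<in> q J" "J' \<in> D" "K' \<in> q J'"
      using K K' by (auto simp: R_def)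
    show "interior K \<inter> interior K' = {}"
    proof (cases "J = J'")
      case True
      then show ?thesis using qD(5) J K' by auto
    next
      case False
      have "K \<subseteq> J" "K' \<subseteq> J'" using qD(2) J by auto
      moreover have "J \<inter> J' = {}" using disj J False by (auto simp: pairwise_def disjnt_def)
      ultimately show ?thesis using interior_subset by blast
    qed
  qed auto
  moreover have "\<Union>R \<subseteq> \<Union>D" using qD(2) by (fastforce simp: R_def)
  moreover have "(\<Sum>k\<in>R. F (Sup k) - F (Inf k)) =
        (\<Sum>k\<in>D. F (Sup k) - F (Inf k)) - (\<Sum>k\<in>D'. F (Sup k) - F (Inf k))" (is "sum ?g R = _")
    for F :: "real \<Rightarrow> real"
  proof -
    have "sum ?g R = (\<Sum>J\<in>D. sum ?g (q J - C J))"
      unfolding R_def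
    proof (rule sum.UNION_disjoint)
      show "\<forall>i\<in>D. finite (q i - C i)" using q(2) by auto
      show "\<forall>i\<in>D. \<forall>j\<in>D. i \<noteq> j \<longrightarrow> (q i - C i) \<inter> (q j - C j) = {}"
      proof (intro ballI impI)
        fix J J' assume J: "J \<in> D" "J' \<in> D" "J \<noteq> J'"
        show "(q J - C J) \<inter> (q J' - C J') = {}"
        proof (rule ccontr)
          assume "(q J - C J) \<inter> (q J' - C J') \<noteq> {}"
          then obtain K where K: "K \<in> q J" "K \<in> q J'" by blast
          show False using uniq[of J J' K] qD(2)[OF J(1) K(1)] qD(2)[OF J(2) K(2)] qD(3)[OF J(1) K(1)] J by simp
        qed
      qed
    qed (use fin in auto)
    also have "\<dots> = (\<Sum>J\<in>D. ?g J - sum ?g (C J))"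
    proof (rule sum.cong)
      fix J assume J: "J \<in> D"
      obtain u v where uv: "u \<le> v" "J = {u..v}" using division_interval_nonempty[OF D J] .
      have "sum ?g (q J) = ?g J"
        using sum_increments_division[of "q J" u v F] q(2)[OF J] uv by simp
      moreover have "sum ?g (q J - C J) = sum ?g (q J) - sum ?g (C J)"
        using q[OF J] by (intro sum_diff) auto
      ultimately show "sum ?g (q J - C J) = ?g J - sum ?g (C J)" by simp
    qed simp
    also have "\<dots> = sum ?g D - (\<Sum>J\<in>D. sum ?g (C J))" by (rule sum_subtractf)
    also have "(\<Sum>J\<in>D. sum ?g (C J)) = sum ?g (\<Union>J\<in>D. C J)"
    proof (rule sum.UNION_disjoint[symmetric])
      show "\<forall>i\<in>D. finite (C i)" using fin by (simp add: C_def)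
      show "\<forall>i\<in>D. \<forall>j\<in>D. i \<noteq> j \<longrightarrow> C i \<inter> C j = {}"
      proof (intro ballI impI)
        fix J J' assume J: "J \<in> D" "J' \<in> D" "J \<noteq> J'"
        show "C J \<inter> C J' = {}"
          using uniq[OF J(1,2)] J(3) division_ofD(3)[OF D'] by (auto simp: C_def)
      qed
    qed (use fin in auto)
    also have "(\<Union>J\<in>D. C J) = D'" using sub by (auto simp: C_def)
    finally show ?thesis .
  qed
  ultimately show ?thesis by (rule that)
qed

text \<open>
  The Vitali covering theorem for closed balls, in the form used with slopes: an interval of the
  covering only has to contain the point, possibly as an end point. Countably many disjoint intervals
  exhaust \<open>S\<close> up to a null set, so by continuity of the measure from above finitely many exhaust it
  up to \<open>e\<close>.
\<close>

lemma Vitali_covering_finite_intervals: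
  fixes S :: "real set" and P :: "real \<Rightarrow> real \<Rightarrow> bool"
  assumes S: "S \<in> lmeasurable"
    and cov: "\<And>t d. t \<in> S \<Longrightarrow> 0 < d \<Longrightarrow> \<exists>u v. u < v \<and> t \<in> {u..v} \<and> v - u < d \<and> P u v"
    and e: "0 < e"
  obtains D where "D division_of \<Union>D" "pairwise disjnt D"
    "\<And>K. K \<in> D \<Longrightarrow> \<exists>u v. u < v \<and> K = {u..v} \<and> P u v"
    "measure lebesgue (S - \<Union>D) < e"
proof -
  define K where "K = {(u,v). u < v \<and> P u v}"
  define c where "c = (\<lambda>(u,v). (u + v) / 2 :: real)"
  define r where "r = (\<lambda>(u,v). (v - u) / 2 :: real)"
  have cb: "cball (c (u,v)) (r (u,v)) = {u..v}" for u v
    by (auto simp: cball_eq_atLeastAtMost c_def r_def field_simps)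
  have cov': "\<exists>i. i \<in> K \<and> t \<in> cball (c i) (r i) \<and> r i < d" if td: "t \<in> S" "0 < d" for t d
  proof -
    obtain u v where "u < v" "t \<in> {u..v}" "v - u < d" "P u v"
      using cov[OF td] by blast
    then show ?thesis using cb[of u v] by (intro exI[of _ "(u,v)"]) (auto simp: K_def r_def)
  qed
  have rpos: "0 < r i" if "i \<in> K" for i using that by (auto simp: K_def r_def)
  obtain C where C: "countable C" "C \<subseteq> K"
     "pairwise (\<lambda>i j. disjnt (cball (c i) (r i)) (cball (c j) (r j))) C"
     "negligible(S - (\<Union>i \<in> C. cball (c i) (r i)))"
    by (rule Vitali_covering_theorem_cballs[of K r S c, OF rpos cov'])
  define D where "D = (\<lambda>i. cball (c i) (r i)) ` C"
  have D: "countable D" using C(1) by (simp add: D_def)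
  have DP: "\<exists>u v. u < v \<and> k = {u..v} \<and> P u v" if kD: "k \<in> D" for k
  proof -
    obtain i where i: "i \<in> C" "k = cball (c i) (r i)" using kD unfolding D_def by blast
    obtain u v where "i = (u,v)" by (cases i)
    then show ?thesis using C(2) i cb[of u v] unfolding K_def by blast
  qed
  have disj: "pairwise disjnt D"
  proof (rule pairwiseI)
    fix k k' assume "k \<in> D" "k' \<in> D" "k \<noteq> k'"
    then obtain i i' where "i \<in> C" "i' \<in> C" "k = cball (c i) (r i)" "k' = cball (c i') (r i')"
      unfolding D_def by blast
    with \<open>k \<noteq> k'\<close> show "disjnt k k'" using pairwiseD[OF C(3), of i i'] by auto
  qed
  obtain A :: "nat \<Rightarrow> real set set" where A: "\<And>n. finite (A n)" "\<And>n. A n \<subseteq> D" "incseq A" "(\<Union>n. A n) = D"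
  proof
    let ?A = "\<lambda>n::nat. D \<inter> to_nat_on D -` {..n}"
    show "finite (?A n)" for n
      using finite_vimage_IntI[OF finite_atMost inj_on_to_nat_on[OF D], of n] by (simp add: Int_commute)
    show "?A n \<subseteq> D" for n by blast
    show "incseq ?A" by (auto simp: incseq_def)
    show "(\<Union>n. ?A n) = D" by auto
  qed
  have bor: "\<Union>(A n) \<in> sets lebesgue" for n
  proof (rule sets.finite_Union)
    show "A n \<subseteq> sets lebesgue"
    proof
      fix k assume "k \<in> A n"
      then obtain u v where "k = {u..v}" using DP A(2) by blast
      then show "k \<in> sets lebesgue" by simp
    qed
  qed (rule A)
  have "(\<lambda>n. measure lebesgue (S - \<Union>(A n))) \<longlonglongrightarrow> measure lebesgue (\<Inter>n. S - \<Union>(A n))"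
  proof (rule Lim_measure_decseq)
    show "range (\<lambda>n. S - \<Union> (A n)) \<subseteq> sets lebesgue" using S bor by auto
    show "decseq (\<lambda>n. S - \<Union> (A n))" using A(3) unfolding decseq_def incseq_def by blast
    have "S - \<Union>(A n) \<in> lmeasurable" for n using S bor by (intro fmeasurable_Diff) auto
    then show "emeasure lebesgue (S - \<Union> (A i)) \<noteq> \<infinity>" for i
      by (metis fmeasurableD2 infinity_ennreal_def)
  qed
  also have "(\<Inter>n. S - \<Union>(A n)) = S - \<Union>D" using A(4) by auto
  also have "measure lebesgue (S - \<Union>D) = 0"
    using C(4) unfolding D_def by (rule negligible_imp_measure0)
  finally have "eventually (\<lambda>n. measure lebesgue (S - \<Union>(A n)) < e) sequentially"
    by (rule order_tendstoD(2)) (rule e)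
  then obtain n where n: "measure lebesgue (S - \<Union>(A n)) < e"
    using eventually_happens[of _ sequentially] by auto
  show ?thesis
  proof (rule that)
    show "pairwise disjnt (A n)" using disj A(2) pairwise_subset by blast
    show "\<exists>u v. u < v \<and> k = {u..v} \<and> P u v" if "k \<in> A n" for k using DP A(2) that by blast
    show "A n division_of \<Union>(A n)"
    proof (rule division_ofI)
      fix k assume k: "k \<in> A n"
      then obtain u v where "u < v" "k = {u..v}" using DP A(2) by blast
      then show "k \<noteq> {}" "\<exists>a b. k = cbox a b" by auto
      fix k' assume "k' \<in> A n" "k \<noteq> k'"
      then have "disjnt k k'" using disj A(2) k unfolding pairwise_def by blast
      then show "interior k \<inter> interior k' = {}" using interior_subset[of k] interior_subset[of k'] unfolding disjnt_def by blast
    qed (use A(1) in auto)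
  qed (rule n)
qed

section \<open>Differentiability almost everywhere of absolutely continuous functions\<close>

text \<open>
  For fixed \<open>u\<close> the slope is continuous in \<open>t \<noteq> u\<close>, so the set of all \<open>t\<close> that have some \<open>u\<close> within
  \<open>1/(n+1)\<close> with slope in \<open>A\<close> is open. The set below is thus a countable intersection of open sets.
\<close>

lemma borel_frequent_slopes:
  fixes F :: "real \<Rightarrow> real"
  assumes F: "continuous_on {a<..<b} F" and A: "open A"
  shows "{t\<in>{a<..<b}. \<exists>\<^sub>F u in at t. (F u - F t) / (u - t) \<in> A} \<in> sets borel"
proof -
  define G where "G n u = {t\<in>{a<..<b} - {u}. (F u - F t) / (u - t) \<in> A} \<inter> ball u (inverse (Suc n))" for n u
  have "open (G n u)" if "u \<in> {a<..<b}" for n u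
  proof -
    have "open {t\<in>{a<..<b} - {u}. (F u - F t) / (u - t) \<in> A}"
      using A that
      by (intro continuous_open_preimage[where f="\<lambda>t. (F u - F t) / (u - t)", unfolded vimage_def Int_def mem_Collect_eq])
         (auto intro!: continuous_intros continuous_on_subset[OF F])
    then show ?thesis unfolding G_def by (intro open_Int) auto
  qed
  then have "open (\<Union>u\<in>{a<..<b}. G n u)" for n by (intro open_UN) auto
  then have "(\<Inter>n. \<Union>u\<in>{a<..<b}. G n u) \<in> sets borel" by (intro sets.countable_INT) auto
  also have "(\<Inter>n. \<Union>u\<in>{a<..<b}. G n u) = {t\<in>{a<..<b}. \<exists>\<^sub>F u in at t. (F u - F t) / (u - t) \<in> A}"
  proof (intro set_eqI iffI)
    fix t assume t: "t \<in> (\<Inter>n. \<Union>u\<in>{a<..<b}. G n u)"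
    have "\<exists>\<^sub>F u in at t. (F u - F t) / (u - t) \<in> A"
      unfolding frequently_at
    proof (intro allI impI)
      fix d :: real assume "d > 0"
      then obtain n where n: "inverse (Suc n) < d" using reals_Archimedean by blast
      obtain u where "u \<in> {a<..<b}" "t \<in> G n u" using t by blast
      then show "\<exists>x\<in>UNIV. x \<noteq> t \<and> dist x t < d \<and> (F x - F t) / (x - t) \<in> A"
        using n by (intro bexI[of _ u]) (auto simp: G_def)
    qed
    then show "t \<in> {t\<in>{a<..<b}. \<exists>\<^sub>F u in at t. (F u - F t) / (u - t) \<in> A}"
      using t by (auto simp: G_def)
  next
    fix t assume t: "t \<in> {t\<in>{a<..<b}. \<exists>\<^sub>F u in at t. (F u - F t) / (u - t) \<in> A}"
    obtain d0 where d0: "d0 > 0" "ball t d0 \<subseteq> {a<..<b}"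
      using t open_contains_ball[of "{a<..<b}"] by (metis (no_types, lifting) mem_Collect_eq open_greaterThanLessThan)
    have "\<exists>u\<in>{a<..<b}. t \<in> G n u" for n
    proof -
      have "min d0 (inverse (Suc n)) > 0" using d0 by simp
      then obtain u where "u \<noteq> t" "dist u t < min d0 (inverse (Suc n))" "(F u - F t) / (u - t) \<in> A"
        using t unfolding frequently_at by blast
      moreover from this have "u \<in> {a<..<b}" using d0(2) by (auto simp: dist_commute)
      ultimately show ?thesis using t by (intro bexI[of _ u]) (auto simp: G_def)
    qed
    then show "t \<in> (\<Inter>n. \<Union>u\<in>{a<..<b}. G n u)" by blast
  qed
  finally show ?thesis .
qed

text \<open>
  Slopes taken to the left and to the right of \<open>t\<close> are increments over an interval with end point
  \<open>t\<close>, so one Vitali covering accounts for both sides.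
\<close>

lemma slope_interval:
  fixes F :: "real \<Rightarrow> real"
  assumes "\<exists>\<^sub>F u in at t. (F u - F t) / (u - t) \<in> A" "0 < d"
  obtains u v where "u < v" "t \<in> {u..v}" "v - u < d" "(F v - F u) / (v - u) \<in> A"
proof -
  obtain s where s: "s \<noteq> t" "dist s t < d" "(F s - F t) / (s - t) \<in> A"
    using assms unfolding frequently_at by blast
  show ?thesis
  proof (cases "s < t")
    case True
    have "(F t - F s) / (t - s) = (F s - F t) / (s - t)"
      by (metis minus_diff_eq minus_divide_divide)
    then show ?thesis using that[of s t] True s by (auto simp: dist_real_def)
  next
    case False
    then show ?thesis using that[of t s] s by (auto simp: dist_real_def)
  qed
qed

lemma AC_continuous_on:
  assumes "absolutely_continuous_on {a..b} F"
  shows "continuous_on {a..b} F"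
  unfolding continuous_on_iff
proof (intro ballI allI impI)
  fix t e :: real assume t: "t \<in> {a..b}" and e: "0 < e"
  obtain d where d: "d > 0" "\<And>D. D division_of \<Union>D \<and> \<Union>D \<subseteq> {a..b} \<and> (\<Sum>k\<in>D. Sup k - Inf k) < d
        \<Longrightarrow> (\<Sum>k\<in>D. \<bar>F (Sup k) - F (Inf k)\<bar>) < e"
    using assms e unfolding absolutely_continuous_on_def by blast
  have "dist (F s) (F t) < e" if s: "s \<in> {a..b}" "dist s t < d" for s
  proof -
    let ?u = "min s t" and ?v = "max s t"
    have "{{?u..?v}} division_of \<Union>{{?u..?v}}" using division_of_self[of "min s t" "max s t"] by (simp add: box_real)
    moreover have "\<Union>{{?u..?v}} \<subseteq> {a..b}" using s t by auto
    moreover have "?u \<le> ?v" by simp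
    ultimately have "\<bar>F ?v - F ?u\<bar> < e"
      using d(2)[of "{{?u..?v}}"] s by (auto simp: dist_real_def)
    then show ?thesis by (auto simp: dist_real_def min_def max_def split: if_splits)
  qed
  then show "\<exists>d>0. \<forall>x'\<in>{a..b}. dist x' t < d \<longrightarrow> dist (F x') (F t) < e" using d(1) by blast
qed

text \<open>
  The classical argument for monotone functions, run directly for absolutely continuous ones. Cover
  \<open>S\<close> almost exactly by intervals with mean slope at most \<open>p\<close>, and then cover \<open>S\<close> inside these by
  intervals with mean slope at least \<open>q\<close>. Both families have total length close to the measure of
  \<open>S\<close>, so the remainder is short and, by absolute continuity, carries a small increment. The two total
  increments are then almost equal, although one is about \<open>p\<close> and the other about \<open>q\<close> times the
  measure of \<open>S\<close>.
\<close>

lemma AC_null_two_slopes: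
  assumes ac: "absolutely_continuous_on {a..b} F" and pq: "p < q"
    and S: "S \<in> lmeasurable" "S \<subseteq> {a<..<b}"
    and lo: "\<And>t. t \<in> S \<Longrightarrow> \<exists>\<^sub>F u in at t. (F u - F t) / (u - t) \<in> {..<p}"
    and hi: "\<And>t. t \<in> S \<Longrightarrow> \<exists>\<^sub>F u in at t. (F u - F t) / (u - t) \<in> {q<..}"
  shows "negligible S"
proof (rule ccontr)
  assume "\<not> negligible S"
  define s where "s = measure lebesgue S"
  have s: "s > 0"
    using \<open>\<not> negligible S\<close> S(1) negligible_iff_measure zero_less_measure_iff unfolding s_def by blast
  \<comment> \<open>With total lengths \<open>j\<close> and \<open>k\<close> of the two families, both within \<open>2 * e\<close> of \<open>s\<close>, the final
    comparison reads \<open>(q - p) * k < \<eta> + \<bar>p\<bar> * (3 * e) \<le> 2 * \<eta>\<close>; these choices contradict \<open>k > s / 2\<close>.\<close>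
  define \<eta> where "\<eta> = (q - p) * s / 8"
  have \<eta>: "\<eta> > 0" using s pq by (simp add: \<eta>_def)
  obtain d where d: "d > 0" "\<And>D. D division_of \<Union>D \<and> \<Union>D \<subseteq> {a..b} \<and> (\<Sum>k\<in>D. Sup k - Inf k) < d
        \<Longrightarrow> (\<Sum>k\<in>D. \<bar>F (Sup k) - F (Inf k)\<bar>) < \<eta>"
    using ac \<eta> unfolding absolutely_continuous_on_def by blast
  define e where "e = min (d / 4) (min (s / 4) (\<eta> / (3 * (\<bar>p\<bar> + 1))))"
  have e: "e > 0" "3 * e < d" "2 * e \<le> s / 2" "\<bar>p\<bar> * (3 * e) \<le> \<eta>"
  proof -
    show "e > 0" using d(1) s \<eta> by (simp add: e_def)
    show "3 * e < d" "2 * e \<le> s / 2" using d(1) s by (auto simp: e_def)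
    have "e \<le> \<eta> / (3 * (\<bar>p\<bar> + 1))" by (simp add: e_def)
    then have "e * (3 * (\<bar>p\<bar> + 1)) \<le> \<eta>" by (subst (asm) pos_le_divide_eq) auto
    then show "\<bar>p\<bar> * (3 * e) \<le> \<eta>" using \<open>e > 0\<close> by (simp add: algebra_simps)
  qed
  obtain O1 where O1: "open O1" "S \<subseteq> O1" "O1 - S \<in> lmeasurable" "emeasure lebesgue (O1 - S) < ennreal e"
    using sets_lebesgue_outer_open[of S e] S(1) e(1) by blast
  have mO1: "O1 \<in> lmeasurable" "measure lebesgue O1 < s + e"
  proof -
    have eq: "O1 = S \<union> (O1 - S)" using O1(2) by blast
    show "O1 \<in> lmeasurable" by (subst eq) (intro fmeasurable.Un S(1) O1(3))
    have "measure lebesgue O1 = s + measure lebesgue (O1 - S)"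
      unfolding s_def by (subst eq, subst measure_Un2[OF S(1) O1(3)]) simp
    moreover have "measure lebesgue (O1 - S) < e"
      using O1(3,4) e(1) by (simp add: emeasure_eq_measure2 ennreal_less_iff)
    ultimately show "measure lebesgue O1 < s + e" by simp
  qed
  have cov1: "\<exists>u v. u < v \<and> t \<in> {u..v} \<and> v - u < r \<and> ({u..v} \<subseteq> O1 \<inter> {a<..<b} \<and> F v - F u \<le> p * (v - u))"
    if t: "t \<in> S" and r: "0 < r" for t r
  proof -
    have "open (O1 \<inter> {a<..<b})" using O1(1) by auto
    moreover have "t \<in> O1 \<inter> {a<..<b}" using t S(2) O1(2) by blast
    ultimately obtain r0 where r0: "r0 > 0" "ball t r0 \<subseteq> O1 \<inter> {a<..<b}"
      unfolding open_contains_ball by blast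
    obtain u v where uv: "u < v" "t \<in> {u..v}" "v - u < min r r0" "(F v - F u) / (v - u) \<in> {..<p}"
      using slope_interval[OF lo[OF t], of "min r r0"] r r0(1) by auto
    have "{u..v} \<subseteq> ball t r0" using uv by (auto simp: dist_real_def)
    moreover have "F v - F u \<le> p * (v - u)" using uv(1,4) by (simp add: pos_divide_less_eq)
    ultimately show ?thesis using uv r0(2) by (intro exI[of _ u] exI[of _ v]) auto
  qed
  obtain D where D: "D division_of \<Union>D" "pairwise disjnt D"
    "\<And>K. K \<in> D \<Longrightarrow> \<exists>u v. u < v \<and> K = {u..v} \<and> ({u..v} \<subseteq> O1 \<inter> {a<..<b} \<and> F v - F u \<le> p * (v - u))"
    "measure lebesgue (S - \<Union>D) < e"
    using Vitali_covering_finite_intervals[OF S(1) cov1 e(1)] by blast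
  \<comment> \<open>Discarding the finitely many end points leaves points interior to their interval of \<open>D\<close>, so
    that small intervals around them stay inside it.\<close>
  define X where "X = S \<inter> \<Union>D - (Inf ` D \<union> Sup ` D)"
  have finX: "finite (Inf ` D \<union> Sup ` D)" using D(1) by auto
  have lD: "\<Union>D \<in> lmeasurable" using D(1) lmeasurable_division by blast
  have X: "X \<in> lmeasurable" "measure lebesgue X > s - e"
  proof -
    have 1: "S \<inter> \<Union>D \<in> lmeasurable" using S(1) lD by (intro fmeasurable.Int) auto
    have N: "Inf ` D \<union> Sup ` D \<in> null_sets lebesgue"
      using negligible_finite[OF finX] by (simp add: negligible_iff_null_sets)
    show "X \<in> lmeasurable" unfolding X_def using 1 N by (intro fmeasurable_Diff) auto
    have "measure lebesgue X = measure lebesgue (S \<inter> \<Union>D)"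
      unfolding X_def using 1 N by (intro measure_Diff_null_set) auto
    moreover have "measure lebesgue (S \<inter> \<Union>D) + measure lebesgue (S - \<Union>D) = s"
    proof -
      have 2: "S - \<Union>D \<in> lmeasurable" using S(1) lD by (intro fmeasurable_Diff) auto
      have "measure lebesgue ((S \<inter> \<Union>D) \<union> (S - \<Union>D)) =
          measure lebesgue (S \<inter> \<Union>D) + measure lebesgue (S - \<Union>D)"
        proof -
        have "S - \<Union>D - S \<inter> \<Union>D = S - \<Union>D" by blast
        then show ?thesis using measure_Un2[OF 1 2] by simp
      qed
      moreover have "(S \<inter> \<Union>D) \<union> (S - \<Union>D) = S" by blast
      ultimately show ?thesis by (simp add: s_def)
    qed
    ultimately show "measure lebesgue X > s - e" using D(4) by linarith
  qed
  have cov2: "\<exists>u v. u < v \<and> t \<in> {u..v} \<and> v - u < r \<and> ((\<exists>J\<in>D. {u..v} \<subseteq> J) \<and> q * (v - u) \<le> F v - F u)"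
    if t: "t \<in> X" and r: "0 < r" for t r
  proof -
    obtain J where J: "J \<in> D" "t \<in> J" using t by (auto simp: X_def)
    obtain c d where cd: "c < d" "J = {c..d}" using D(3)[OF J(1)] by blast
    have "t \<noteq> Inf J" "t \<noteq> Sup J" using t J(1) by (auto simp: X_def)
    then have tc: "c < t" "t < d" using cd J by auto
    define r0 where "r0 = min r (min (t - c) (d - t))"
    have r0: "r0 > 0" using r tc by (simp add: r0_def)
    have tS: "t \<in> S" using t by (simp add: X_def)
    obtain u v where uv: "u < v" "t \<in> {u..v}" "v - u < r0" "(F v - F u) / (v - u) \<in> {q<..}"
      using slope_interval[OF hi[OF tS] r0] by blast
    have "{u..v} \<subseteq> J" using uv cd by (auto simp: r0_def)
    moreover have "q * (v - u) \<le> F v - F u" using uv(1,4) by (simp add: pos_less_divide_eq)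
    moreover have "v - u < r" using uv(3) by (simp add: r0_def)
    ultimately show ?thesis using uv J(1) by blast
  qed
  obtain D2 where D2: "D2 division_of \<Union>D2" "pairwise disjnt D2"
    "\<And>K. K \<in> D2 \<Longrightarrow> \<exists>u v. u < v \<and> K = {u..v} \<and> ((\<exists>J\<in>D. {u..v} \<subseteq> J) \<and> q * (v - u) \<le> F v - F u)"
    "measure lebesgue (X - \<Union>D2) < e"
    using Vitali_covering_finite_intervals[OF X(1) cov2 e(1)] by blast
  have lD2: "\<Union>D2 \<in> lmeasurable" using D2(1) lmeasurable_division by blast
  have sub: "\<exists>J\<in>D. K \<subseteq> J" if "K \<in> D2" for K using D2(3)[OF that] by blast
  obtain R where R: "R division_of \<Union>R" "\<Union>R \<subseteq> \<Union>D"
    "\<And>F :: real \<Rightarrow> real. (\<Sum>k\<in>R. F (Sup k) - F (Inf k)) =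
        (\<Sum>k\<in>D. F (Sup k) - F (Inf k)) - (\<Sum>k\<in>D2. F (Sup k) - F (Inf k))"
    using division_remainder[OF D(1) D2(1) D(2) sub] by blast
  define j where "j = (\<Sum>k\<in>D. Sup k - Inf k)"
  define k where "k = (\<Sum>k\<in>D2. Sup k - Inf k)"
  have j: "j < s + e"
  proof -
    have "\<Union>D \<subseteq> O1" using D(3) by blast
    then have "measure lebesgue (\<Union>D) \<le> measure lebesgue O1"
      using lD mO1(1) by (intro measure_mono_fmeasurable) auto
    then show ?thesis using mO1(2) measure_Union_division[OF D(1)] by (simp add: j_def)
  qed
  have k: "k > s - 2 * e"
  proof -
    have "measure lebesgue X \<le> measure lebesgue (\<Union>D2 \<union> (X - \<Union>D2))"
      using X lD2 by (intro measure_mono_fmeasurable) auto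
    also have "\<dots> \<le> measure lebesgue (\<Union>D2) + measure lebesgue (X - \<Union>D2)"
      using X lD2 by (intro measure_Un_le) auto
    finally show ?thesis using X(2) D2(4) measure_Union_division[OF D2(1)] by (simp add: k_def)
  qed
  have jF: "(\<Sum>k\<in>D. F (Sup k) - F (Inf k)) \<le> p * j"
    unfolding j_def sum_distrib_left
  proof (rule sum_mono)
    fix K assume "K \<in> D"
    then obtain u v where "u < v" "K = {u..v}" "F v - F u \<le> p * (v - u)" using D(3) by blast
    then show "F (Sup K) - F (Inf K) \<le> p * (Sup K - Inf K)" by simp
  qed
  have kF: "q * k \<le> (\<Sum>k\<in>D2. F (Sup k) - F (Inf k))"
    unfolding k_def sum_distrib_left
  proof (rule sum_mono)
    fix K assume "K \<in> D2"
    then obtain u v where "u < v" "K = {u..v}" "q * (v - u) \<le> F v - F u" using D2(3) by blast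
    then show "q * (Sup K - Inf K) \<le> F (Sup K) - F (Inf K)" by simp
  qed
  have len: "(\<Sum>k\<in>R. Sup k - Inf k) = j - k" using R(3)[of "\<lambda>t. t"] by (simp add: j_def k_def)
  have "\<Union>D \<subseteq> {a<..<b}" using D(3) by blast
  then have "\<Union>R \<subseteq> {a..b}"
    using order_trans[OF R(2)] greaterThanLessThan_subseteq_atLeastAtMost_iff[of a b a b] by (metis order_refl order_trans)
  moreover have "(\<Sum>k\<in>R. Sup k - Inf k) < d" using len j k e(2) by linarith
  ultimately have "(\<Sum>k\<in>R. \<bar>F (Sup k) - F (Inf k)\<bar>) < \<eta>"
    using d(2)[of R] R(1) by blast
  then have "\<bar>\<Sum>k\<in>R. F (Sup k) - F (Inf k)\<bar> < \<eta>"
    by (rule le_less_trans[OF sum_abs])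
  then have "- \<eta> < p * j - q * k" using R(3)[of F] jF kF by linarith
  moreover have "p * (j - k) \<le> \<bar>p\<bar> * (3 * e)"
  proof -
    have "0 \<le> j - k" unfolding len[symmetric]
      by (rule sum_nonneg) (auto elim!: division_interval_nonempty[OF R(1)])
    then have "p * (j - k) \<le> \<bar>p\<bar> * (j - k)" by (intro mult_right_mono) auto
    also have "\<dots> \<le> \<bar>p\<bar> * (3 * e)" using j k by (intro mult_left_mono) auto
    finally show ?thesis .
  qed
  ultimately have "(q - p) * k < 2 * \<eta>" using e(4) by (simp add: algebra_simps)
  moreover have "(q - p) * (s / 2) \<le> (q - p) * k" using pq k e(3) by (intro mult_left_mono) auto
  then have "(q - p) * s / 2 \<le> (q - p) * k" by simp
  ultimately have "(q - p) * s < 0" unfolding \<eta>_def by linarith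
  then show False using pq s by (simp add: mult_less_0_iff)
qed

text \<open>
  In a window shorter than the \<open>\<delta>\<close> that belongs to \<open>\<epsilon> = 1\<close>, increments over disjoint intervals sum
  to less than \<open>1\<close>; intervals with mean slope beyond \<open>n\<close> that fill half of a set of measure \<open>s\<close>
  would contribute at least \<open>n * s / 2\<close>.
\<close>

lemma AC_null_unbounded_slopes:
  assumes ac: "absolutely_continuous_on {a..b} F"
    and S: "S \<in> lmeasurable" "S \<subseteq> {a<..<b}"
    and unb: "\<And>t n. t \<in> S \<Longrightarrow> \<exists>\<^sub>F u in at t. (F u - F t) / (u - t) \<in> {z. real n < \<bar>z\<bar>}"
  shows "negligible S"
proof -
  obtain d where d: "d > 0" "\<And>D. D division_of \<Union>D \<and> \<Union>D \<subseteq> {a..b} \<and> (\<Sum>k\<in>D. Sup k - Inf k) < d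
        \<Longrightarrow> (\<Sum>k\<in>D. \<bar>F (Sup k) - F (Inf k)\<bar>) < 1"
    using ac[unfolded absolutely_continuous_on_def, rule_format, OF zero_less_one] by blast
  have "negligible (S \<inter> {c - d/4<..<c + d/4})" for c
  proof (rule ccontr)
    define X where "X = S \<inter> {c - d/4<..<c + d/4}"
    assume "\<not> negligible (S \<inter> {c - d/4<..<c + d/4})"
    then have nX: "\<not> negligible X" by (simp add: X_def)
    have Xl: "X \<in> lmeasurable" unfolding X_def using S(1) by (intro fmeasurable.Int) auto
    define s where "s = measure lebesgue X"
    have s: "s > 0"
      using nX Xl negligible_iff_measure zero_less_measure_iff unfolding s_def by blast
    obtain n :: nat where n: "2 / s < real n" using reals_Archimedean2 by blast
    have cov1: "\<exists>u v. u < v \<and> t \<in> {u..v} \<and> v - u < r \<and>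
        ({u..v} \<subseteq> {c - d/4<..<c + d/4} \<inter> {a<..<b} \<and> real n * (v - u) \<le> \<bar>F v - F u\<bar>)"
      if t: "t \<in> X" and r: "0 < r" for t r
    proof -
      have "open ({c - d/4<..<c + d/4} \<inter> {a<..<b})" by auto
      moreover have "t \<in> {c - d/4<..<c + d/4} \<inter> {a<..<b}" using t S(2) unfolding X_def by blast
      ultimately obtain r0 where r0: "r0 > 0" "ball t r0 \<subseteq> {c - d/4<..<c + d/4} \<inter> {a<..<b}"
        unfolding open_contains_ball by blast
      have tS: "t \<in> S" using t by (simp add: X_def)
      obtain u v where uv: "u < v" "t \<in> {u..v}" "v - u < min r r0" "(F v - F u) / (v - u) \<in> {z. real n < \<bar>z\<bar>}"
        using slope_interval[OF unb[OF tS], of "min r r0" n] r r0(1) by (simp only: min_less_iff_conj) blast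
      have "{u..v} \<subseteq> ball t r0" using uv by (auto simp: dist_real_def)
      moreover have "real n * (v - u) \<le> \<bar>F v - F u\<bar>" using uv(1,4) by (simp add: abs_divide pos_less_divide_eq)
      ultimately show ?thesis using uv r0(2) by (intro exI[of _ u] exI[of _ v]) auto
    qed
    obtain D where D: "D division_of \<Union>D" "pairwise disjnt D"
      "\<And>K. K \<in> D \<Longrightarrow> \<exists>u v. u < v \<and> K = {u..v} \<and>
         ({u..v} \<subseteq> {c - d/4<..<c + d/4} \<inter> {a<..<b} \<and> real n * (v - u) \<le> \<bar>F v - F u\<bar>)"
      "measure lebesgue (X - \<Union>D) < s / 2"
      using Vitali_covering_finite_intervals[OF Xl cov1 half_gt_zero[OF s]] by blast
    have lD: "\<Union>D \<in> lmeasurable" using D(1) lmeasurable_division by blast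
    define j where "j = (\<Sum>k\<in>D. Sup k - Inf k)"
    have "j \<le> measure lebesgue {c - d/4<..<c + d/4}"
      unfolding j_def measure_Union_division[OF D(1), symmetric]
    proof (rule measure_mono_fmeasurable)
      show "\<Union>D \<subseteq> {c - d/4<..<c + d/4}" using D(3) by blast
    qed (use lD in auto)
    also have "\<dots> < d" using d(1) by simp
    finally have jd: "j < d" .
    have "s \<le> measure lebesgue (\<Union>D \<union> (X - \<Union>D))"
      unfolding s_def using Xl lD by (intro measure_mono_fmeasurable) auto
    also have "\<dots> \<le> measure lebesgue (\<Union>D) + measure lebesgue (X - \<Union>D)"
      using Xl lD by (intro measure_Un_le) auto
    finally have js: "s / 2 < j" using D(4) measure_Union_division[OF D(1)] by (simp add: j_def)
    have "\<Union>D \<subseteq> {a<..<b}" using D(3) by blast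
    then have "\<Union>D \<subseteq> {a..b}"
      using greaterThanLessThan_subseteq_atLeastAtMost_iff[of a b a b] by (metis order_refl order_trans)
    then have "(\<Sum>k\<in>D. \<bar>F (Sup k) - F (Inf k)\<bar>) < 1" using d(2)[of D] D(1) jd unfolding j_def by blast
    moreover have "real n * j \<le> (\<Sum>k\<in>D. \<bar>F (Sup k) - F (Inf k)\<bar>)"
      unfolding j_def sum_distrib_left
    proof (rule sum_mono)
      fix K assume "K \<in> D"
      then obtain u v where "u < v" "K = {u..v}" "real n * (v - u) \<le> \<bar>F v - F u\<bar>" using D(3) by blast
      then show "real n * (Sup K - Inf K) \<le> \<bar>F (Sup K) - F (Inf K)\<bar>" by simp
    qed
    moreover have "1 \<le> real n * j"
    proof -
      have "1 = 2 / s * (s / 2)" using s by simp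
      also have "\<dots> \<le> real n * j" using n js s by (intro mult_mono) auto
      finally show ?thesis .
    qed
    ultimately show False by linarith
  qed
  then have "\<exists>U. openin (top_of_set S) U \<and> c \<in> U \<and> negligible U" if "c \<in> S" for c
    using d(1) that by (intro exI[of _ "S \<inter> {c - d/4<..<c + d/4}"]) (auto intro!: openin_open_Int)
  then show ?thesis unfolding locally_negligible_alt[of S] by blast
qed

text \<open>
  The limit is the lower limit of \<open>s\<close>. Only rational thresholds are tested, so that the failure of
  convergence splits into countably many cases.
\<close>

lemma tendsto_if_no_oscillation:
  fixes s :: "'a \<Rightarrow> real"
  assumes F: "F \<noteq> bot" and bdd: "\<forall>\<^sub>F u in F. \<bar>s u\<bar> \<le> B"
    and osc: "\<And>p q :: rat. p < q \<Longrightarrow> \<not> ((\<exists>\<^sub>F u in F. s u < of_rat p) \<and> (\<exists>\<^sub>F u in F. s u > of_rat q))"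
  shows "\<exists>l. (s \<longlongrightarrow> l) F"
proof -
  define l where "l = Sup {r. \<forall>\<^sub>F u in F. r \<le> s u}"
  have bddA: "bdd_above {r. \<forall>\<^sub>F u in F. r \<le> s u}"
  proof (rule bdd_aboveI)
    fix r assume "r \<in> {r. \<forall>\<^sub>F u in F. r \<le> s u}"
    then have "\<forall>\<^sub>F u in F. r \<le> B" using bdd by (auto elim: eventually_elim2)
    then show "r \<le> B" using F by simp
  qed
  have ne: "- B \<in> {r. \<forall>\<^sub>F u in F. r \<le> s u}" using bdd by (auto elim!: eventually_mono)
  have lower: "\<forall>\<^sub>F u in F. c < s u" if cl: "c < l" for c
  proof -
    have "{r. \<forall>\<^sub>F u in F. r \<le> s u} \<noteq> {}" using ne by (metis empty_iff)
    from less_cSupE[OF cl[unfolded l_def] this]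
    obtain r where r: "r \<in> {r. \<forall>\<^sub>F u in F. r \<le> s u}" "c < r" .
    then have "\<forall>\<^sub>F u in F. r \<le> s u" by simp
    then show ?thesis using r(2) by (auto elim!: eventually_mono)
  qed
  have upper: "\<forall>\<^sub>F u in F. s u < c" if lc: "l < c" for c
  proof -
    obtain p :: rat where p: "l < of_rat p" "of_rat p < c" using of_rat_dense[OF lc] by blast
    obtain q :: rat where q: "of_rat p < (of_rat q :: real)" "of_rat q < c" using of_rat_dense[OF p(2)] by blast
    have "\<not> (\<forall>\<^sub>F u in F. of_rat p \<le> s u)"
      using p(1) cSup_upper[OF _ bddA, of "of_rat p"] unfolding l_def by auto
    then have "\<exists>\<^sub>F u in F. s u < of_rat p" by (simp add: frequently_def not_less)
    then have "\<not> (\<exists>\<^sub>F u in F. s u > of_rat q)" using osc[of p q] q(1) by (auto simp: of_rat_less)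
    then show ?thesis using q(2) by (auto simp: frequently_def elim!: eventually_mono)
  qed
  have "(s \<longlongrightarrow> l) F" by (rule order_tendstoI[OF lower upper])
  then show ?thesis ..
qed

text \<open>
  A point without a derivative has unbounded difference quotients, or they oscillate across some
  rational interval; each of these countably many sets is null.
\<close>

lemma AC_negligible_nondifferentiable:
  assumes ac: "absolutely_continuous_on {a..b} F"
  shows "negligible {t\<in>{a<..<b}. \<not> F differentiable (at t)}"
proof -
  define f where "f A = {t\<in>{a<..<b}. \<exists>\<^sub>F u in at t. (F u - F t) / (u - t) \<in> A}" for A
  have cont: "continuous_on {a<..<b} F"
    using AC_continuous_on[OF ac] by (rule continuous_on_subset) auto
  have bor: "f A \<in> lmeasurable" if "open A" for A
  proof (rule bounded_set_imp_lmeasurable)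
    show "bounded (f A)" by (rule bounded_subset[of "{a<..<b}"]) (auto simp: f_def)
    show "f A \<in> sets lebesgue" using borel_frequent_slopes[OF cont that] by (simp add: f_def)
  qed
  \<comment> \<open>Unbounded slopes are in \<open>E\<close>; oscillation across \<open>[p,q]\<close> is in \<open>G p q\<close>.\<close>
  define E where "E = (\<Inter>n::nat. f {z. real n < \<bar>z\<bar>})"
  define G where "G p q = f {..<real_of_rat p} \<inter> f {real_of_rat q<..}" for p q
  have op: "open {z. real n < \<bar>z\<bar>}" for n by (intro open_Collect_less continuous_intros)
  have E: "negligible E"
  proof (rule AC_null_unbounded_slopes[OF ac])
    have "E = f {z. real 0 < \<bar>z\<bar>} \<inter> E" unfolding E_def by blast
    also have "\<dots> \<in> lmeasurable"
    proof (rule fmeasurable_Int_fmeasurable)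
      show "E \<in> sets lebesgue"
        unfolding E_def using bor[OF op] by (intro sets.countable_INT) (auto simp: fmeasurableD)
    qed (rule bor[OF op])
    finally show "E \<in> lmeasurable" .
  qed (auto simp: E_def f_def)
  have G: "negligible (G p q)" if "p < q" for p q
  proof (rule AC_null_two_slopes[OF ac])
    show "real_of_rat p < real_of_rat q" using that by (simp add: of_rat_less)
    show "G p q \<in> lmeasurable" unfolding G_def by (intro fmeasurable.Int bor) auto
  qed (auto simp: G_def f_def)
  have "negligible (E \<union> (\<Union>p. \<Union>q\<in>{p<..}. G p q))"
    using E G by (intro negligible_Un negligible_countable_Union) (auto intro!: negligible_countable_Union)
  moreover have "{t\<in>{a<..<b}. \<not> F differentiable (at t)} \<subseteq> E \<union> (\<Union>p. \<Union>q\<in>{p<..}. G p q)"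
  proof (rule subsetI, rule ccontr)
    fix t assume t: "t \<in> {t\<in>{a<..<b}. \<not> F differentiable (at t)}"
      and nt: "t \<notin> E \<union> (\<Union>p. \<Union>q\<in>{p<..}. G p q)"
    obtain n where n: "t \<notin> f {z. real n < \<bar>z\<bar>}" using nt unfolding E_def by blast
    have "\<exists>l. ((\<lambda>u. (F u - F t) / (u - t)) \<longlongrightarrow> l) (at t)"
    proof (rule tendsto_if_no_oscillation)
      show "\<forall>\<^sub>F u in at t. \<bar>(F u - F t) / (u - t)\<bar> \<le> real n"
        using n t by (simp add: f_def frequently_def not_less)
      fix p q :: rat assume "p < q"
      then have "t \<notin> G p q" using nt by blast
      then show "\<not> ((\<exists>\<^sub>F u in at t. (F u - F t) / (u - t) < of_rat p) \<and> (\<exists>\<^sub>F u in at t. (F u - F t) / (u - t) > of_rat q))"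
        using t by (auto simp: G_def f_def)
    qed simp
    then obtain l where "(F has_real_derivative l) (at t)"
      unfolding has_field_derivative_iff by blast
    then show False using t by (auto simp: real_differentiable_def)
  qed
  ultimately show ?thesis by (rule negligible_subset)
qed

section \<open>The fundamental theorem of calculus for absolutely continuous functions\<close>

text \<open>
  The derivative, set to \<open>0\<close> on the null set \<open>N\<close> of exceptional points, is integrated with a gauge:
  at a regular point the gauge makes the increment close to derivative times length, and at a
  point of \<open>N\<close> it keeps the interval inside an open set of small measure, where absolute continuity
  bounds the sum of the increments.
\<close>

lemma AC_FTC:
  assumes ac: "absolutely_continuous_on {a..b} F" and ab: "a \<le> b"
  shows "(deriv F has_integral (F b - F a)) {a..b}"
proof -
  define N where "N = insert a (insert b {t\<in>{a<..<b}. \<not> F differentiable (at t)})"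
  have N: "negligible N" using AC_negligible_nondifferentiable[OF ac] by (simp add: N_def)
  define f where "f t = (if t \<in> N then 0 else deriv F t)" for t
  have der: "(F has_real_derivative f t) (at t)" if "t \<in> {a..b}" "t \<notin> N" for t
  proof -
    have "F differentiable (at t)" using that by (auto simp: N_def)
    then have "F field_differentiable (at t)" by (simp add: field_differentiable_def real_differentiable_def)
    then show ?thesis using that by (simp add: f_def field_differentiable_derivI)
  qed
  have "(f has_integral (F b - F a)) (cbox a b)"
    unfolding has_integral
  proof (intro allI impI)
    fix e :: real assume e: "0 < e"
    define \<epsilon> where "\<epsilon> = e / (2 * (b - a + 1))"
    have \<epsilon>: "\<epsilon> > 0" "\<epsilon> * (b - a) < e / 2"
      using e ab by (auto simp: \<epsilon>_def field_simps)
    obtain d where d: "d > 0" "\<And>D. D division_of \<Union>D \<and> \<Union>D \<subseteq> {a..b} \<and> (\<Sum>k\<in>D. Sup k - Inf k) < d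
        \<Longrightarrow> (\<Sum>k\<in>D. \<bar>F (Sup k) - F (Inf k)\<bar>) < e / 2"
      using ac e unfolding absolutely_continuous_on_def by (meson half_gt_zero)
    obtain U where U: "open U" "N \<subseteq> U" "U \<in> lmeasurable" "measure lebesgue U < d"
    proof -
      obtain U where U: "open U" "N \<subseteq> U" "U - N \<in> lmeasurable" "emeasure lebesgue (U - N) < ennreal d"
        using sets_lebesgue_outer_open[OF negligible_imp_sets[OF N] d(1)] by blast
      have Nl: "N \<in> lmeasurable" "measure lebesgue N = 0"
        using N negligible_imp_measurable negligible_imp_measure0 by auto
      have eq: "U = N \<union> (U - N)" using U(2) by blast
      have "U \<in> lmeasurable" by (subst eq) (intro fmeasurable.Un Nl U)
      moreover have "measure lebesgue U = measure lebesgue (U - N)"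
        by (subst eq, subst measure_Un2[OF Nl(1) U(3)]) (simp add: Nl)
      moreover have "measure lebesgue (U - N) < d"
        using U(3,4) d(1) by (simp add: emeasure_eq_measure2 ennreal_less_iff)
      ultimately show ?thesis using that U by simp
    qed
    have "\<exists>r>0. \<forall>s. \<bar>s - t\<bar> < r \<longrightarrow> \<bar>F s - F t - f t * (s - t)\<bar> \<le> \<epsilon> * \<bar>s - t\<bar>"
      if t: "t \<in> {a..b}" "t \<notin> N" for t
    proof -
      have "(F has_derivative (\<lambda>h. f t * h)) (at t)"
        using der[OF t] by (simp add: has_field_derivative_def)
      then show ?thesis
        using \<epsilon>(1) unfolding has_derivative_at_alt by (auto simp: mult.commute)
    qed
    then obtain r where r: "\<And>t. t \<in> {a..b} \<Longrightarrow> t \<notin> N \<Longrightarrow> r t > 0"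
      "\<And>t s. t \<in> {a..b} \<Longrightarrow> t \<notin> N \<Longrightarrow> \<bar>s - t\<bar> < r t \<Longrightarrow> \<bar>F s - F t - f t * (s - t)\<bar> \<le> \<epsilon> * \<bar>s - t\<bar>"
      by metis
    \<comment> \<open>Gauges are defined on the whole line; the unit ball is an arbitrary choice outside \<open>[a,b]\<close>.\<close>
    define \<gamma> where "\<gamma> t = (if t \<in> N then U else if t \<in> {a..b} then ball t (r t) else ball t 1)" for t
    have "gauge \<gamma>"
      unfolding gauge_def \<gamma>_def using U(1,2) r(1) by auto
    moreover have fine_sum: "norm ((\<Sum>(t,k)\<in>p. measure lborel k *\<^sub>R f t) - (F b - F a)) < e"
      if p: "p tagged_division_of cbox a b" "\<gamma> fine p" for p
    proof -
      have fin: "finite p" using p(1) by auto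
      note pD = tagged_division_ofD[OF p(1)]
      define g where "g = (\<lambda>(t::real,k::real set). measure lborel k *\<^sub>R f t - (F (Sup k) - F (Inf k)))"
      define pN where "pN = {x\<in>p. fst x \<in> N}"
      have ival: "\<exists>u v. k = {u..v} \<and> u \<le> t \<and> t \<le> v \<and> a \<le> u \<and> v \<le> b" if tk: "(t,k) \<in> p" for t k
      proof -
        obtain u v where "k = cbox u v" using pD(4)[OF tk] by blast
        then show ?thesis using pD(2,3)[OF tk] ab by (auto simp: subset_iff)
      qed
      have "(\<Sum>(t,k)\<in>p. measure lborel k *\<^sub>R f t) - (F b - F a) = sum g p"
        using additive_tagged_division_1[OF ab, of p F] p(1)
        by (simp add: g_def sum_subtractf case_prod_unfold)
      also have "\<dots> = sum g pN + sum g (p - pN)"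
        using fin by (subst sum.subset_diff[of pN p]) (auto simp: pN_def)
      finally have split: "(\<Sum>(t,k)\<in>p. measure lborel k *\<^sub>R f t) - (F b - F a) = sum g pN + sum g (p - pN)" .
      \<comment> \<open>Regular tags: split the interval at its tag and use the derivative on both sides.\<close>
      have "\<bar>sum g (p - pN)\<bar> \<le> (\<Sum>x\<in>p - pN. \<bar>g x\<bar>)" by (rule sum_abs)
      also have "\<dots> \<le> (\<Sum>(t,k)\<in>p - pN. \<epsilon> * measure lborel k)"
      proof (rule sum_mono, clarify)
        fix t k assume tk: "(t,k) \<in> p" "(t,k) \<notin> pN"
        obtain u v where uv: "k = {u..v}" "u \<le> t" "t \<le> v" "a \<le> u" "v \<le> b" using ival[OF tk(1)] by blast
        have tN: "t \<in> {a..b}" "t \<notin> N" using uv tk by (auto simp: pN_def)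
        have "k \<subseteq> ball t (r t)" using fineD[OF p(2) tk(1)] tN by (simp add: \<gamma>_def)
        then have "u \<in> ball t (r t)" "v \<in> ball t (r t)"
          using uv by (meson atLeastAtMost_iff order_refl order_trans subsetD)+
        then have "\<bar>u - t\<bar> < r t" "\<bar>v - t\<bar> < r t" by (auto simp: dist_real_def)
        then have "\<bar>F u - F t - f t * (u - t)\<bar> \<le> \<epsilon> * \<bar>u - t\<bar>" "\<bar>F v - F t - f t * (v - t)\<bar> \<le> \<epsilon> * \<bar>v - t\<bar>"
          using r(2)[OF tN] by auto
        moreover have "\<epsilon> * \<bar>u - t\<bar> + \<epsilon> * \<bar>v - t\<bar> = \<epsilon> * (v - u)" using uv by (simp add: algebra_simps)
        moreover have "(v - u) * f t - (F v - F u) = (F u - F t - f t * (u - t)) - (F v - F t - f t * (v - t))"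
          by (simp add: algebra_simps)
        ultimately have "\<bar>(v - u) * f t - (F v - F u)\<bar> \<le> \<epsilon> * (v - u)" by linarith
        then show "\<bar>g (t, k)\<bar> \<le> \<epsilon> * measure lborel k" using uv by (simp add: g_def)
      qed
      also have "\<dots> \<le> (\<Sum>(t,k)\<in>p. \<epsilon> * measure lborel k)"
        using fin \<epsilon>(1) by (intro sum_mono2) auto
      also have "\<dots> = \<epsilon> * (b - a)"
        using additive_content_tagged_division[OF p(1)] ab
        by (simp add: sum_distrib_left[symmetric] case_prod_unfold)
      finally have good: "\<bar>sum g (p - pN)\<bar> < e / 2" using \<epsilon>(2) by linarith
      have "pN tagged_partial_division_of cbox a b"
        using tagged_partial_division_subset[of p "cbox a b" pN] p(1)
        by (auto simp: pN_def tagged_division_of_def)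
      then have pN_td: "pN tagged_division_of (\<Union>(snd ` pN))"
        by (rule tagged_partial_division_of_Union_self)
      have dv: "snd ` pN division_of \<Union>(snd ` pN)"
        using division_of_tagged_division[OF pN_td] .
      \<comment> \<open>Exceptional tags: \<open>f\<close> vanishes there, and the increments are summed over the distinct
        intervals. Two tags can only share a degenerate interval, whose increment is \<open>0\<close>.\<close>
      have "\<bar>sum g pN\<bar> \<le> (\<Sum>x\<in>pN. \<bar>g x\<bar>)" by (rule sum_abs)
      also have "\<dots> = (\<Sum>(t,k)\<in>pN. \<bar>F (Sup k) - F (Inf k)\<bar>)"
        by (rule sum.cong) (auto simp: g_def pN_def f_def)
      also have "\<dots> = (\<Sum>(t,k)\<in>pN. if k = {} then 0 else \<bar>F (Sup k) - F (Inf k)\<bar>)"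
        by (intro sum.cong) (auto simp: pN_def dest: pD(2))
      also have "\<dots> = (\<Sum>k\<in>snd ` pN. if k = {} then 0 else \<bar>F (Sup k) - F (Inf k)\<bar>)"
        by (rule sum.over_tagged_division_lemma[OF pN_td]) auto
      also have "\<dots> = (\<Sum>k\<in>snd ` pN. \<bar>F (Sup k) - F (Inf k)\<bar>)"
        using division_ofD(3)[OF dv] by (intro sum.cong) auto
      also have "\<dots> < e / 2"
      proof (rule d(2), intro conjI)
        have pN: "\<exists>t. (t,k) \<in> p \<and> t \<in> N" if "k \<in> snd ` pN" for k
          using that by (auto simp: pN_def)
        have "k \<subseteq> {a..b}" if "k \<in> snd ` pN" for k using pN[OF that] pD(3) by auto
        then show "\<Union>(snd ` pN) \<subseteq> {a..b}" by (rule Union_least)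
        have "k \<subseteq> U" if "k \<in> snd ` pN" for k
          using pN[OF that] fineD[OF p(2)] unfolding \<gamma>_def by metis
        then have "\<Union>(snd ` pN) \<subseteq> U" by (rule Union_least)
        then have "measure lebesgue (\<Union>(snd ` pN)) \<le> measure lebesgue U"
          using U(3) lmeasurable_division[OF dv] by (intro measure_mono_fmeasurable) auto
        then show "(\<Sum>k\<in>snd ` pN. Sup k - Inf k) < d"
          using U(4) measure_Union_division[OF dv] by linarith
      qed (rule dv)
      finally show ?thesis unfolding split using good by simp
    qed
    ultimately show "\<exists>\<gamma>. gauge \<gamma> \<and> (\<forall>\<D>. \<D> tagged_division_of cbox a b \<and> \<gamma> fine \<D> \<longrightarrow>
            norm ((\<Sum>(x,K)\<in>\<D>. measure lborel K *\<^sub>R f x) - (F b - F a)) < e)"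
      using fine_sum by (intro exI[of _ \<gamma>]) simp
  qed
  then have "(f has_integral (F b - F a)) {a..b}" by simp
  then show ?thesis
    using has_integral_spike[OF N, of "{a..b}" "deriv F" f "F b - F a"] by (simp add: f_def)
qed

section \<open>Composition of Riemann-Liouville integrals\<close>

text \<open>
  The Beta integral, transported from \<open>[0,1]\<close> to \<open>[r,\<tau>]\<close>.
\<close>

lemma has_integral_Beta_kernel:
  fixes a b r \<tau> :: real
  assumes a: "a > 0" and b: "b > 0" and r: "r < \<tau>"
  shows "((\<lambda>s. (\<tau> - s) powr (a - 1) * (s - r) powr (b - 1)) has_integral (\<tau> - r) powr (a + b - 1) * Beta a b) {r..\<tau>}"
proof -
  define m where "m = 1 / (\<tau> - r)"
  have m: "m > 0" using r by (simp add: m_def)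
  have "((\<lambda>t. t powr (b - 1) * (1 - t) powr (a - 1)) has_integral Beta a b) (cbox 0 1)"
    using has_integral_Beta_real[OF b a] by (simp add: Beta_commute)
  from has_integral_affinity[OF this, of m "- r * m"]
  have I: "((\<lambda>s. (m * s - r * m) powr (b - 1) * (1 - (m * s - r * m)) powr (a - 1)) has_integral (\<tau> - r) * Beta a b)
      ((\<lambda>x. (1 / m) * x + r) ` {0..1})"
    using m r by (simp add: m_def)
  have im: "(\<lambda>x. (1 / m) * x + r) ` {0..1} = {r..\<tau>}"
    using r image_affinity_atLeastAtMost[of "\<tau> - r" r 0 1] by (simp add: m_def)
  have scaled: "((\<lambda>s. (\<tau> - r) powr (a + b - 2) * ((m * s - r * m) powr (b - 1) * (1 - (m * s - r * m)) powr (a - 1)))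
      has_integral (\<tau> - r) powr (a + b - 2) * ((\<tau> - r) * Beta a b)) {r..\<tau>}"
    using I unfolding im by (rule has_integral_mult_right)
  have total: "(\<tau> - r) powr (a + b - 2) * ((\<tau> - r) * Beta a b) = (\<tau> - r) powr (a + b - 1) * Beta a b"
    using r powr_mult_base[of "\<tau> - r" "a + b - 2"] by (simp add: mult_ac)
  have "(\<tau> - r) powr (a + b - 2) * ((m * s - r * m) powr (b - 1) * (1 - (m * s - r * m)) powr (a - 1))
      = (\<tau> - s) powr (a - 1) * (s - r) powr (b - 1)" if s: "s \<in> {r..\<tau>}" for s
  proof -
    have 1: "m * s - r * m = (s - r) / (\<tau> - r)" by (simp add: m_def diff_divide_distrib)
    have 2: "1 - (m * s - r * m) = (\<tau> - s) / (\<tau> - r)" unfolding 1 using r by (simp add: field_simps)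
    have "(\<tau> - r) powr (a + b - 2) = (\<tau> - r) powr (a - 1) * (\<tau> - r) powr (b - 1)"
      by (simp flip: powr_add)
    then show ?thesis
      unfolding 2 unfolding 1 using s r by (simp add: powr_divide)
  qed
  from has_integral_eq[OF this scaled] show ?thesis unfolding total .
qed

lemma Beta_kernel_lborel:
  fixes a b r \<tau> :: real
  assumes "a > 0" and "b > 0" and "r < \<tau>"
  shows "has_bochner_integral lborel (\<lambda>s. indicator {r..\<tau>} s * ((\<tau> - s) powr (a - 1) * (s - r) powr (b - 1)))
            ((\<tau> - r) powr (a + b - 1) * Beta a b)"
proof (rule has_bochner_integral_nn_integral)
  show "(\<integral>\<^sup>+ s. ennreal (indicator {r..\<tau>} s * ((\<tau> - s) powr (a - 1) * (s - r) powr (b - 1))) \<partial>lborel)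
     = ennreal ((\<tau> - r) powr (a + b - 1) * Beta a b)"
    using nn_integral_has_integral_lebesgue[OF _ has_integral_Beta_kernel[OF assms]] by simp
  show "0 \<le> (\<tau> - r) powr (a + b - 1) * Beta a b"
    using assms by (simp add: Beta_def Gamma_real_pos less_imp_le)
qed (auto simp: indicator_def)

text \<open>
  Fubini's theorem on the triangle \<open>0 \<le> r \<le> s \<le> \<tau>\<close>. The integral over \<open>s\<close> is evaluated by the Beta
  kernel, and the same evaluation with \<open>\<bar>Y\<bar>\<close> supplies the absolute integrability.
\<close>

lemma Beta_kernel_convolution:
  fixes Y :: "real \<Rightarrow> real"
  assumes pos: "0 < \<mu>" "0 < \<nu>" and Y[measurable]: "Y \<in> borel_measurable borel"
    and int: "integrable lborel (\<lambda>r. indicator {0..\<tau>} r * ((\<tau> - r) powr (\<mu> + \<nu> - 1) * Y r))"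
  shows "(\<integral>s. indicator {0..\<tau>} s * ((\<tau> - s) powr (\<mu> - 1) *
            (\<integral>r. indicator {0..s} r * ((s - r) powr (\<nu> - 1) * Y r) \<partial>lborel)) \<partial>lborel)
       = Beta \<mu> \<nu> * (\<integral>r. indicator {0..\<tau>} r * ((\<tau> - r) powr (\<mu> + \<nu> - 1) * Y r) \<partial>lborel)"
proof -
  define k where "k r s = (if 0 \<le> r \<and> r \<le> s \<and> s \<le> \<tau> then (\<tau> - s) powr (\<mu> - 1) * (s - r) powr (\<nu> - 1) else 0)" for r s
  have km[measurable]: "case_prod k \<in> borel_measurable (borel \<Otimes>\<^sub>M borel)"
    unfolding k_def by measurable
  have k_nn: "k r s \<ge> 0" for r s by (simp add: k_def)
  have kint: "has_bochner_integral lborel (\<lambda>s. k r s) (indicator {0..\<tau>} r * ((\<tau> - r) powr (\<mu> + \<nu> - 1) * Beta \<mu> \<nu>))"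
    for r
  proof (cases "0 \<le> r \<and> r < \<tau>")
    case True
    have "k r = (\<lambda>s. indicator {r..\<tau>} s * ((\<tau> - s) powr (\<mu> - 1) * (s - r) powr (\<nu> - 1)))"
      using True by (auto simp: k_def fun_eq_iff)
    then show ?thesis using Beta_kernel_lborel[OF pos, of r \<tau>] True by simp
  next
    case False
    then have "k r = (\<lambda>s. 0)" by (auto simp: k_def fun_eq_iff)
    moreover have "indicator {0..\<tau>} r * ((\<tau> - r) powr (\<mu> + \<nu> - 1) * Beta \<mu> \<nu>) = 0"
      using False by (auto simp: indicator_def)
    ultimately show ?thesis by (simp only: has_bochner_integral_zero)
  qed
  note kI = has_bochner_integral_integral_eq[OF kint] and kin = integrable.intros[OF kint]
  have "integrable (lborel \<Otimes>\<^sub>M lborel) (case_prod (\<lambda>r s. k r s * Y r))"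
  proof (rule lborel_pair.Fubini_integrable)
    show "case_prod (\<lambda>r s. k r s * Y r) \<in> borel_measurable (lborel \<Otimes>\<^sub>M lborel)"
      by measurable
    have "(\<integral>s. norm (case (r, s) of (r, s) \<Rightarrow> k r s * Y r) \<partial>lborel) =
        Beta \<mu> \<nu> * \<bar>indicator {0..\<tau>} r * ((\<tau> - r) powr (\<mu> + \<nu> - 1) * Y r)\<bar>" for r
      using kI[of r] k_nn by (simp add: abs_mult)
    then show "integrable lborel (\<lambda>r. \<integral>s. norm (case (r, s) of (r, s) \<Rightarrow> k r s * Y r) \<partial>lborel)"
      using int by (simp only:) (intro integrable_mult_right integrable_abs)
    show "AE r in lborel. integrable lborel (\<lambda>s. case (r, s) of (r, s) \<Rightarrow> k r s * Y r)"
      using kin by (intro AE_I2) simp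
  qed
  from lborel_pair.Fubini_integral[OF this]
  have "(\<integral>s. (\<integral>r. k r s * Y r \<partial>lborel) \<partial>lborel) = (\<integral>r. (\<integral>s. k r s * Y r \<partial>lborel) \<partial>lborel)" .
  also have "(\<lambda>r. \<integral>s. k r s * Y r \<partial>lborel) =
      (\<lambda>r. Beta \<mu> \<nu> * (indicator {0..\<tau>} r * ((\<tau> - r) powr (\<mu> + \<nu> - 1) * Y r)))"
    using kI by (simp add: mult_ac)
  also have "(\<lambda>s. \<integral>r. k r s * Y r \<partial>lborel) = (\<lambda>s. indicator {0..\<tau>} s * ((\<tau> - s) powr (\<mu> - 1) *
            (\<integral>r. indicator {0..s} r * ((s - r) powr (\<nu> - 1) * Y r) \<partial>lborel)))"
  proof
    fix s
    have "(\<lambda>r. k r s * Y r) = (\<lambda>r. indicator {0..\<tau>} s * ((\<tau> - s) powr (\<mu> - 1)) * (indicator {0..s} r * ((s - r) powr (\<nu> - 1) * Y r)))"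
      by (auto simp: k_def fun_eq_iff indicator_def)
    then show "(\<integral>r. k r s * Y r \<partial>lborel) = indicator {0..\<tau>} s * ((\<tau> - s) powr (\<mu> - 1) *
            (\<integral>r. indicator {0..s} r * ((s - r) powr (\<nu> - 1) * Y r) \<partial>lborel))"
      by (simp add: mult.assoc)
  qed
  finally show ?thesis by simp
qed

text \<open>
  The integrand \<open>y\<close> is only Lebesgue measurable, while Fubini's theorem is used for the Borel measure;
  \<open>y\<close> is therefore replaced by a Borel function that agrees with it almost everywhere on \<open>[0,\<tau>)\<close>.
\<close>

lemma RL_integral_semigroup:
  assumes pos: "0 < \<mu>" "0 < \<nu>" and int: "RL_integrable (\<mu> + \<nu>) y \<tau>"
  shows "RL_integral \<mu> (RL_integral \<nu> y) \<tau> = RL_integral (\<mu> + \<nu>) y \<tau>"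
proof -
  \<comment> \<open>Multiplying the integrand by the reciprocal kernel recovers \<open>y\<close> on \<open>[0,\<tau>)\<close> and shows that it is
    measurable there; at \<open>\<tau>\<close> the kernel vanishes.\<close>
  define Y where "Y r = indicator {0..<\<tau>} r * y r" for r
  have "(\<lambda>r. indicator {0..\<tau>} r *\<^sub>R ((\<tau> - r) powr (\<mu> + \<nu> - 1) * y r)) \<in> borel_measurable lebesgue"
    using int by (auto simp: RL_integrable_def set_integrable_def)
  moreover have "(\<lambda>r. (\<tau> - r) powr (1 - (\<mu> + \<nu>))) \<in> borel_measurable lebesgue"
    by (intro measurable_completion) measurable
  ultimately have "(\<lambda>r. (\<tau> - r) powr (1 - (\<mu> + \<nu>)) * (indicator {0..\<tau>} r *\<^sub>R ((\<tau> - r) powr (\<mu> + \<nu> - 1) * y r))) \<in> borel_measurable lebesgue"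
    by (rule borel_measurable_times[rotated])
  also have "(\<lambda>r. (\<tau> - r) powr (1 - (\<mu> + \<nu>)) * (indicator {0..\<tau>} r *\<^sub>R ((\<tau> - r) powr (\<mu> + \<nu> - 1) * y r))) = Y"
  proof
    fix r
    have "(\<tau> - r) powr (1 - (\<mu> + \<nu>)) * (\<tau> - r) powr (\<mu> + \<nu> - 1) = (if r = \<tau> then 0 else 1)"
      by (simp flip: powr_add)
    then show "(\<tau> - r) powr (1 - (\<mu> + \<nu>)) * (indicator {0..\<tau>} r *\<^sub>R ((\<tau> - r) powr (\<mu> + \<nu> - 1) * y r)) = Y r"
      by (auto simp: Y_def indicator_def)
  qed
  finally have Yl: "Y \<in> borel_measurable lebesgue" .
  obtain Z where Z[measurable]: "Z \<in> borel_measurable borel" and YZ: "AE r in lborel. Y r = Z r"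
    using completion_ex_borel_measurable_real[OF Yl] by auto
  have inner: "(LINT r:{0..s}|lebesgue. (s - r) powr (\<rho> - 1) * y r) =
      (\<integral>r. indicator {0..s} r * ((s - r) powr (\<rho> - 1) * Z r) \<partial>lborel)" if s: "s \<le> \<tau>" for s \<rho>
  proof -
    have "(LINT r:{0..s}|lebesgue. (s - r) powr (\<rho> - 1) * y r) =
        (\<integral>r. (indicator {0..s} r * (s - r) powr (\<rho> - 1)) * Y r \<partial>lebesgue)"
      unfolding set_lebesgue_integral_def
      by (rule Bochner_Integration.integral_cong) (use s in \<open>auto simp: Y_def indicator_def\<close>)
    also have "\<dots> = (\<integral>r. (indicator {0..s} r * (s - r) powr (\<rho> - 1)) * Z r \<partial>lebesgue)"
    proof (rule integral_cong_AE)
      have k: "(\<lambda>r. indicator {0..s} r * (s - r) powr (\<rho> - 1)) \<in> borel_measurable lebesgue"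
        by (intro measurable_completion) measurable
      show "(\<lambda>r. (indicator {0..s} r * (s - r) powr (\<rho> - 1)) * Y r) \<in> borel_measurable lebesgue"
        by (rule borel_measurable_times[OF k Yl])
      show "(\<lambda>r. (indicator {0..s} r * (s - r) powr (\<rho> - 1)) * Z r) \<in> borel_measurable lebesgue"
        by (rule borel_measurable_times[OF k]) (intro measurable_completion, measurable)
      show "AE r in lebesgue. indicator {0..s} r * (s - r) powr (\<rho> - 1) * Y r = indicator {0..s} r * (s - r) powr (\<rho> - 1) * Z r"
        using AE_completion[OF YZ] by eventually_elim simp
    qed
    also have "\<dots> = (\<integral>r. (indicator {0..s} r * (s - r) powr (\<rho> - 1)) * Z r \<partial>lborel)"
      by (rule integral_completion) measurable
    finally show ?thesis by (simp add: mult.assoc)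
  qed
  have Zint: "integrable lborel (\<lambda>r. indicator {0..\<tau>} r * ((\<tau> - r) powr (\<mu> + \<nu> - 1) * Z r))"
  proof -
    have "integrable lebesgue (\<lambda>r. indicator {0..\<tau>} r * ((\<tau> - r) powr (\<mu> + \<nu> - 1) * Z r))"
    proof (rule integrable_cong_AE_imp)
      show "integrable lebesgue (\<lambda>r. indicator {0..\<tau>} r *\<^sub>R ((\<tau> - r) powr (\<mu> + \<nu> - 1) * y r))"
        using int by (auto simp: RL_integrable_def set_integrable_def)
      show "(\<lambda>r. indicator {0..\<tau>} r * ((\<tau> - r) powr (\<mu> + \<nu> - 1) * Z r)) \<in> borel_measurable lebesgue"
        by (intro measurable_completion) measurable
      show "AE r in lebesgue. indicator {0..\<tau>} r *\<^sub>R ((\<tau> - r) powr (\<mu> + \<nu> - 1) * y r) = indicator {0..\<tau>} r * ((\<tau> - r) powr (\<mu> + \<nu> - 1) * Z r)"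
        using AE_completion[OF YZ]
      proof eventually_elim
        case (elim r)
        then show ?case by (cases "r = \<tau>") (auto simp: Y_def indicator_def)
      qed
    qed
    then show ?thesis by (subst (asm) integrable_completion) measurable
  qed
  have "(LINT s:{0..\<tau>}|lebesgue. (\<tau> - s) powr (\<mu> - 1) * RL_integral \<nu> y s) =
     (\<integral>s. 1 / Gamma \<nu> * (indicator {0..\<tau>} s * ((\<tau> - s) powr (\<mu> - 1) *
            (\<integral>r. indicator {0..s} r * ((s - r) powr (\<nu> - 1) * Z r) \<partial>lborel))) \<partial>lebesgue)"
    unfolding set_lebesgue_integral_def
    by (rule Bochner_Integration.integral_cong) (auto simp: RL_integral_def inner indicator_def)
  also have "\<dots> = (\<integral>s. 1 / Gamma \<nu> * (indicator {0..\<tau>} s * ((\<tau> - s) powr (\<mu> - 1) *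
            (\<integral>r. indicator {0..s} r * ((s - r) powr (\<nu> - 1) * Z r) \<partial>lborel))) \<partial>lborel)"
    by (rule integral_completion) (simp add: indicator_def, measurable)
  also have "\<dots> = 1 / Gamma \<nu> * (Beta \<mu> \<nu> * (\<integral>r. indicator {0..\<tau>} r * ((\<tau> - r) powr (\<mu> + \<nu> - 1) * Z r) \<partial>lborel))"
    by (simp only: integral_mult_right_zero Beta_kernel_convolution[OF pos Z Zint])
  finally have eq: "(LINT s:{0..\<tau>}|lebesgue. (\<tau> - s) powr (\<mu> - 1) * RL_integral \<nu> y s) =
     1 / Gamma \<nu> * (Beta \<mu> \<nu> * (LINT r:{0..\<tau>}|lebesgue. (\<tau> - r) powr (\<mu> + \<nu> - 1) * y r))"
    by (simp only: inner[OF order_refl])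
  have "Gamma \<mu> > 0" "Gamma \<nu> > 0" using pos by (auto intro: Gamma_real_pos)
  then show ?thesis
    unfolding RL_integral_def[of \<mu>] RL_integral_def[of "\<mu> + \<nu>"] eq by (simp add: Beta_def)
qed

lemma RL_integral_1_deriv:
  assumes ac: "x \<in> AC_halfline" and int: "RL_integrable 1 (deriv x) \<tau>" and \<tau>: "0 < \<tau>"
  shows "RL_integral 1 (deriv x) \<tau> = x \<tau> - x 0"
proof -
  have "(deriv x has_integral x \<tau> - x 0) {0..\<tau>}"
    using ac \<tau> by (intro AC_FTC) (auto simp: AC_halfline_def)
  \<comment> \<open>Since \<open>0 powr 0 = 0\<close>, the kernel of order \<open>1\<close> differs from \<open>1\<close> at \<open>s = \<tau>\<close>.\<close>
  then have "((\<lambda>s. (\<tau> - s) powr (1 - 1) * deriv x s) has_integral x \<tau> - x 0) {0..\<tau>}"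
    by (rule has_integral_spike[OF negligible_sing[of \<tau>], rotated]) auto
  moreover have "(LINT s:{0..\<tau>}|lebesgue. (\<tau> - s) powr (1 - 1) * deriv x s) =
      integral {0..\<tau>} (\<lambda>s. (\<tau> - s) powr (1 - 1) * deriv x s)"
    using int unfolding RL_integrable_def by (rule set_lebesgue_integral_eq_integral(2))
  ultimately show ?thesis unfolding RL_integral_def by (simp add: integral_unique)
qed

text \<open>
  \<open>I\<^sup>\<alpha> I\<^bsup>1-\<alpha>\<^esup> x' = I\<^sup>1 x' = x - x(0)\<close>.
\<close>

lemma caputo_inversion:
  assumes x: "x \<in> C_frac \<alpha>" and \<alpha>: "0 < \<alpha>" "\<alpha> < 1" and \<tau>: "0 < \<tau>"
  shows "x \<tau> = x 0 + RL_integral \<alpha> (caputo \<alpha> x) \<tau>"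
proof -
  have int: "RL_integrable 1 (deriv x) \<tau>"
    using RL_integrable_lower_order[OF x \<alpha>(1) \<tau>] by simp
  have "caputo \<alpha> x = RL_integral (1 - \<alpha>) (deriv x)"
    using \<alpha> by (simp add: caputo_def fun_eq_iff)
  then have "RL_integral \<alpha> (caputo \<alpha> x) \<tau> = RL_integral 1 (deriv x) \<tau>"
    using RL_integral_semigroup[of \<alpha> "1 - \<alpha>" "deriv x" \<tau>] int \<alpha> by simp
  also have "\<dots> = x \<tau> - x 0"
    using x int \<tau> by (intro RL_integral_1_deriv) (auto simp: C_frac_def)
  finally show ?thesis by simp
qed

text \<open>
  \<open>I\<^bsup>\<alpha>-\<beta>\<^esup> I\<^bsup>1-\<alpha>\<^esup> x' = I\<^bsup>1-\<beta>\<^esup> x'\<close>.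
\<close>

lemma caputo_lower_order:
  assumes x: "x \<in> C_frac \<alpha>" and \<alpha>: "0 < \<beta>" "\<beta> < \<alpha>" "\<alpha> < 1" and \<tau>: "0 < \<tau>"
  shows "caputo \<beta> x \<tau> = RL_integral (\<alpha> - \<beta>) (caputo \<alpha> x) \<tau>"
proof -
  have int: "RL_integrable (1 - \<beta>) (deriv x) \<tau>"
    using RL_integrable_lower_order[OF x \<alpha>(2) \<tau>] .
  have "caputo \<alpha> x = RL_integral (1 - \<alpha>) (deriv x)"
    using \<alpha> by (simp add: caputo_def fun_eq_iff)
  then show ?thesis
    using RL_integral_semigroup[of "\<alpha> - \<beta>" "1 - \<alpha>" "deriv x" \<tau>] int \<alpha> by (simp add: caputo_def)
qed

section \<open>Bounds for Riemann-Liouville integrals\<close>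

text \<open>
  Young's inequality after normalising both factors to norm \<open>1\<close>; a factor of norm \<open>0\<close> vanishes almost
  everywhere.
\<close>

lemma Holder_integral:
  fixes u v :: "'a \<Rightarrow> real"
  assumes pq: "p > 1" "q > 1" "1 / p + 1 / q = 1"
    and [measurable]: "u \<in> borel_measurable M" "v \<in> borel_measurable M"
    and nn: "\<And>s. 0 \<le> u s" "\<And>s. 0 \<le> v s"
    and int: "integrable M (\<lambda>s. u s powr p)" "integrable M (\<lambda>s. v s powr q)"
  shows "integrable M (\<lambda>s. u s * v s)"
    and "(\<integral>s. u s * v s \<partial>M) \<le> (\<integral>s. u s powr p \<partial>M) powr (1 / p) * (\<integral>s. v s powr q \<partial>M) powr (1 / q)"
proof -
  define A where "A = (\<integral>s. u s powr p \<partial>M)"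
  define B where "B = (\<integral>s. v s powr q \<partial>M)"
  have Y: "u s * v s \<le> u s powr p / p + v s powr q / q" for s
    using Youngs_inequality[OF pq nn] .
  have I: "integrable M (\<lambda>s. u s powr p / p + v s powr q / q)" using int by simp
  show uv: "integrable M (\<lambda>s. u s * v s)"
    by (rule Bochner_Integration.integrable_bound[OF I])
       (use Y nn pq in \<open>auto intro!: AE_I2 order_trans[OF Y]\<close>)
  have AB: "A \<ge> 0" "B \<ge> 0" by (auto simp: A_def B_def)
  show "(\<integral>s. u s * v s \<partial>M) \<le> A powr (1 / p) * B powr (1 / q)"
  proof (cases "A = 0 \<or> B = 0")
    case True
    have "AE s in M. u s * v s = 0"
    proof (cases "A = 0")
      case True
      then have "AE s in M. u s powr p = 0"
        using integral_nonneg_eq_0_iff_AE[OF int(1)] by (simp add: A_def)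
      then show ?thesis by eventually_elim simp
    next
      case False
      with \<open>A = 0 \<or> B = 0\<close> have "B = 0" by simp
      then have "AE s in M. v s powr q = 0"
        using integral_nonneg_eq_0_iff_AE[OF int(2)] by (simp add: B_def)
      then show ?thesis by eventually_elim simp
    qed
    then have "(\<integral>s. u s * v s \<partial>M) = 0" by (simp add: integral_eq_zero_AE)
    then show ?thesis by simp
  next
    case False
    then have AB: "A > 0" "B > 0" using AB by auto
    define a where "a = A powr (1 / p)"
    define b where "b = B powr (1 / q)"
    have ab: "a > 0" "b > 0" "a powr p = A" "b powr q = B"
      using AB pq by (auto simp: a_def b_def powr_powr)
    have "u s * v s \<le> a * b * (u s powr p / (p * A) + v s powr q / (q * B))" for s
    proof -
      have "u s / a * (v s / b) \<le> (u s / a) powr p / p + (v s / b) powr q / q"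
        using nn ab by (intro Youngs_inequality pq) auto
      also have "\<dots> = u s powr p / (p * A) + v s powr q / (q * B)"
        using nn ab by (simp add: powr_divide mult.commute)
      finally show ?thesis using ab by (simp add: field_simps)
    qed
    then have "(\<integral>s. u s * v s \<partial>M) \<le> (\<integral>s. a * b * (u s powr p / (p * A) + v s powr q / (q * B)) \<partial>M)"
      using int by (intro integral_mono uv) auto
    also have "\<dots> = a * b * (A / (p * A) + B / (q * B))"
      using int by (simp add: A_def B_def)
    also have "\<dots> = a * b" using AB pq by simp
    finally show ?thesis by (simp add: a_def b_def)
  qed
qed

text \<open>
  A non-integrable \<open>f\<close> has integral \<open>0\<close>, so the bound holds for arbitrary \<open>f\<close>. This spares every
  later estimate a proof that the Riemann-Liouville integrand is measurable.
\<close>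

lemma abs_integral_le_dominating:
  fixes f G :: "'a \<Rightarrow> real"
  assumes G: "integrable M G" and le: "AE s in M. \<bar>f s\<bar> \<le> G s"
  shows "\<bar>integral\<^sup>L M f\<bar> \<le> integral\<^sup>L M G"
proof (cases "integrable M f")
  case True
  have "\<bar>integral\<^sup>L M f\<bar> \<le> (\<integral>s. \<bar>f s\<bar> \<partial>M)" by (rule integral_abs_bound)
  also have "\<dots> \<le> integral\<^sup>L M G" using True G le by (intro integral_mono_AE) auto
  finally show ?thesis .
next
  case False
  have "AE s in M. 0 \<le> G s" using le by eventually_elim auto
  then show ?thesis using False by (simp add: not_integrable_integral_eq integral_nonneg_AE)
qed

lemma RL_integral_dominated:
  assumes \<mu>: "0 < \<mu>"
    and int: "integrable lborel (\<lambda>s. indicator {0..\<tau>} s * ((\<tau> - s) powr (\<mu> - 1) * d s))"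
    and le: "\<And>s. 0 < s \<Longrightarrow> s < \<tau> \<Longrightarrow> \<bar>g s\<bar> \<le> d s"
  shows "\<bar>RL_integral \<mu> g \<tau>\<bar> \<le>
    1 / Gamma \<mu> * (\<integral>s. indicator {0..\<tau>} s * ((\<tau> - s) powr (\<mu> - 1) * d s) \<partial>lborel)"
proof -
  have meas: "(\<lambda>s. indicator {0..\<tau>} s * ((\<tau> - s) powr (\<mu> - 1) * d s)) \<in> borel_measurable lborel"
    using int by (rule borel_measurable_integrable)
  have G: "Gamma \<mu> > 0" using \<mu> by (rule Gamma_real_pos)
  have "\<bar>LINT s:{0..\<tau>}|lebesgue. (\<tau> - s) powr (\<mu> - 1) * g s\<bar> \<le>
      (\<integral>s. indicator {0..\<tau>} s * ((\<tau> - s) powr (\<mu> - 1) * d s) \<partial>lebesgue)"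
    unfolding set_lebesgue_integral_def
  proof (rule abs_integral_le_dominating)
    show "integrable lebesgue (\<lambda>s. indicator {0..\<tau>} s * ((\<tau> - s) powr (\<mu> - 1) * d s))"
      using int integrable_completion[OF meas] by simp
    have "AE s in lebesgue. s \<noteq> 0 \<and> s \<noteq> \<tau>"
      by (rule AE_completion) (simp add: AE_lborel_singleton)
    then show "AE s in lebesgue. \<bar>indicator {0..\<tau>} s *\<^sub>R ((\<tau> - s) powr (\<mu> - 1) * g s)\<bar>
        \<le> indicator {0..\<tau>} s * ((\<tau> - s) powr (\<mu> - 1) * d s)"
      by eventually_elim (auto simp: indicator_def abs_mult intro!: mult_left_mono le)
  qed
  also have "\<dots> = (\<integral>s. indicator {0..\<tau>} s * ((\<tau> - s) powr (\<mu> - 1) * d s) \<partial>lborel)"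
    using meas by (rule integral_completion)
  finally show ?thesis
    unfolding RL_integral_def abs_mult using G by (intro mult_mono) auto
qed

lemma RL_integral_locally_bounded:
  assumes \<mu>: "0 < \<mu>" and T: "0 < T" and g: "\<And>s. 0 < s \<Longrightarrow> s \<le> T \<Longrightarrow> \<bar>g s\<bar> \<le> G"
  shows "\<exists>B. \<forall>\<tau>\<in>{0<..T}. \<bar>RL_integral \<mu> g \<tau>\<bar> \<le> B"
proof (intro exI ballI)
  fix \<tau> assume "\<tau> \<in> {0<..T}"
  then have \<tau>: "0 < \<tau>" "\<tau> \<le> T" by auto
  have G: "0 \<le> G" using g[of T] T by linarith
  have eq: "indicator {0..\<tau>} s * ((\<tau> - s) powr (\<mu> - 1) * (G * s powr 0)) =
      G * (indicator {0..\<tau>} s * ((\<tau> - s) powr (\<mu> - 1) * (s - 0) powr (1 - 1)))" for s by simp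
  note ker = has_bochner_integral_mult_right[OF Beta_kernel_lborel[OF \<mu> zero_less_one \<tau>(1)], of G]
  have "\<bar>RL_integral \<mu> g \<tau>\<bar> \<le>
      1 / Gamma \<mu> * (\<integral>s. indicator {0..\<tau>} s * ((\<tau> - s) powr (\<mu> - 1) * (G * s powr 0)) \<partial>lborel)"
    using g \<tau> integrable.intros[OF ker] by (intro RL_integral_dominated[OF \<mu>]) (auto simp only: eq, simp)
  also have "\<dots> = 1 / Gamma \<mu> * (G * (\<tau> powr \<mu> * Beta \<mu> 1))"
    unfolding eq using has_bochner_integral_integral_eq[OF ker] by simp
  also have "\<dots> \<le> 1 / Gamma \<mu> * (G * (T powr \<mu> * Beta \<mu> 1))"
    using \<mu> \<tau> G by (intro mult_left_mono mult_right_mono powr_mono2) (auto simp: Beta_def Gamma_real_pos less_imp_le)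
  finally show "\<bar>RL_integral \<mu> g \<tau>\<bar> \<le> 1 / Gamma \<mu> * (G * (T powr \<mu> * Beta \<mu> 1))" .
qed

text \<open>
  For \<open>p\<close> conjugate to \<open>q\<close>, this is the \<open>L\<^sub>p\<close> norm on \<open>[0,1]\<close> of the kernel
  \<open>(1 - s) powr (\<mu> - 1) * s powr (1/q - \<alpha>) / Gamma \<mu>\<close>.
\<close>

definition weighted_RL_norm :: "real \<Rightarrow> real \<Rightarrow> real \<Rightarrow> real" where
  "weighted_RL_norm q \<alpha> \<mu> = (let p = q / (q - 1) in
     Beta (p * (\<mu> - 1) + 1) (p * (1 / q - \<alpha>) + 1) powr (1 / p) / Gamma \<mu>)"

text \<open>
  Hoelder's inequality against the kernel \<open>(\<tau> - s) powr (\<mu> - 1) * s powr (1/q - \<alpha>)\<close>, whose \<open>p\<close>-th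
  power is a Beta kernel. The condition \<open>1/q < \<mu>\<close> makes it integrable at \<open>s = \<tau>\<close> and \<open>\<alpha> < 1\<close> at
  \<open>s = 0\<close>; by the choice of the weight, the powers of \<open>\<tau>\<close> combine to \<open>\<mu> - \<alpha>\<close>.
\<close>

lemma RL_integral_weighted_bound:
  assumes q: "q > 1" and \<mu>: "1 / q < \<mu>" and \<alpha>: "\<alpha> < 1" and \<tau>: "0 < \<tau>"
    and vm: "(\<lambda>s. indicator {0..\<tau>} s * v s) \<in> borel_measurable lborel"
    and vnn: "\<And>s. 0 \<le> s \<Longrightarrow> 0 \<le> v s"
    and vint: "integrable lborel (\<lambda>s. indicator {0..\<tau>} s * v s powr q)"
    and g: "\<And>s. 0 < s \<Longrightarrow> \<bar>g s\<bar> \<le> s powr (1 / q - \<alpha>) * v s"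
  shows "\<bar>RL_integral \<mu> g \<tau>\<bar> \<le> weighted_RL_norm q \<alpha> \<mu> * \<tau> powr (\<mu> - \<alpha>) *
           (\<integral>s. indicator {0..\<tau>} s * v s powr q \<partial>lborel) powr (1 / q)"
proof -
  define p where "p = q / (q - 1)"
  have p: "p > 1" "1 / p + 1 / q = 1" using q by (auto simp: p_def field_simps)
  have \<mu>0: "0 < \<mu>" using \<mu> q by (smt (verit) divide_pos_pos)
  have pq: "p * (1 / q - 1) = - 1" using q by (simp add: p_def field_simps)
  \<comment> \<open>The \<open>p\<close>-th power of the weighted kernel is the Beta kernel with parameters \<open>a\<close> and \<open>c\<close>.\<close>
  define a where "a = p * (\<mu> - 1) + 1"
  define c where "c = p * (1 / q - \<alpha>) + 1"
  have "p * (\<mu> - 1) > p * (1 / q - 1)" "p * (1 / q - \<alpha>) > p * (1 / q - 1)"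
    using p \<mu> \<alpha> by (auto intro!: mult_strict_left_mono)
  then have ac: "a > 0" "c > 0" using pq by (auto simp: a_def c_def)
  have "a + c - 1 = p * (\<mu> - \<alpha>) + p * (1 / q - 1) + 1" by (simp add: a_def c_def algebra_simps)
  then have acp: "a + c - 1 = p * (\<mu> - \<alpha>)" using pq by simp
  have G: "Gamma \<mu> > 0" using \<mu>0 by (rule Gamma_real_pos)
  have B: "Beta a c \<ge> 0" using ac by (simp add: Beta_def Gamma_real_pos less_imp_le)
  define u where "u s = indicator {0..\<tau>} s * ((\<tau> - s) powr (\<mu> - 1) * s powr (1 / q - \<alpha>))" for s
  define V where "V s = indicator {0..\<tau>} s * v s" for s
  have um: "u \<in> borel_measurable lborel" unfolding u_def by measurable
  have up: "u s powr p = indicator {0..\<tau>} s * ((\<tau> - s) powr (a - 1) * (s - 0) powr (c - 1))" for s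
    using p by (auto simp: u_def indicator_def powr_mult powr_powr a_def c_def mult.commute)
  have Vq: "V s powr q = indicator {0..\<tau>} s * v s powr q" for s
    by (auto simp: V_def indicator_def)
  note ker = Beta_kernel_lborel[OF ac \<tau>, folded up]
  have uV: "u s * V s = indicator {0..\<tau>} s * ((\<tau> - s) powr (\<mu> - 1) * (s powr (1 / q - \<alpha>) * v s))" for s
    by (simp add: u_def V_def indicator_def)
  have nn: "\<And>s. 0 \<le> u s" "\<And>s. 0 \<le> V s" using vnn by (auto simp: u_def V_def indicator_def)
  have Vm: "V \<in> borel_measurable lborel" using vm by (simp add: V_def[abs_def])
  have Vint: "integrable lborel (\<lambda>s. V s powr q)" using vint by (simp add: Vq)
  note H = Holder_integral[OF p(1) q p(2) um Vm nn integrable.intros[OF ker] Vint]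
  have "\<bar>RL_integral \<mu> g \<tau>\<bar> \<le> 1 / Gamma \<mu> * (\<integral>s. u s * V s \<partial>lborel)"
    unfolding uV using H(1) unfolding uV by (intro RL_integral_dominated[OF \<mu>0] g) auto
  also have "\<dots> \<le> 1 / Gamma \<mu> * ((\<integral>s. u s powr p \<partial>lborel) powr (1 / p) * (\<integral>s. V s powr q \<partial>lborel) powr (1 / q))"
    using G by (intro mult_left_mono H(2)) auto
  also have "(\<integral>s. u s powr p \<partial>lborel) = \<tau> powr (a + c - 1) * Beta a c"
    using has_bochner_integral_integral_eq[OF ker] by simp
  also have "(\<tau> powr (a + c - 1) * Beta a c) powr (1 / p) = \<tau> powr (\<mu> - \<alpha>) * Beta a c powr (1 / p)"
    using p(1) B by (simp add: acp powr_mult powr_powr)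
  finally show ?thesis
    unfolding weighted_RL_norm_def Let_def a_def[symmetric] p_def[symmetric] c_def[symmetric]
    by (simp add: Vq mult_ac)
qed

lemma weighted_RL_norm_nonneg:
  assumes "0 < \<mu>"
  shows "0 \<le> weighted_RL_norm q \<alpha> \<mu>"
  using Gamma_real_pos[OF assms] by (simp add: weighted_RL_norm_def Let_def)

lemma C_halfline_ext_locally_bounded:
  assumes g: "g \<in> C_halfline_ext" and T: "0 < T"
  shows "\<exists>G. \<forall>s\<in>{0<..T}. \<bar>g s\<bar> \<le> G"
proof -
  obtain l where l: "(g \<longlongrightarrow> l) (at_right 0)" using g by (auto simp: C_halfline_ext_def)
  then have "\<forall>\<^sub>F s in at_right 0. dist (g s) l < 1" by (rule tendstoD) simp
  then obtain d where d: "0 < d" "\<And>s. 0 < s \<Longrightarrow> s < d \<Longrightarrow> dist (g s) l < 1"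
    unfolding eventually_at_right_field by blast
  have "continuous_on {d..T} g"
    using g d(1) by (auto simp: C_halfline_ext_def elim!: continuous_on_subset)
  then have "bounded (g ` {d..T})"
    by (intro compact_imp_bounded compact_continuous_image) auto
  then obtain B where B: "\<And>s. s \<in> {d..T} \<Longrightarrow> \<bar>g s\<bar> \<le> B"
    unfolding bounded_iff by (metis image_eqI real_norm_def)
  have "\<bar>g s\<bar> \<le> max B (\<bar>l\<bar> + 1)" if s: "s \<in> {0<..T}" for s
  proof (cases "s < d")
    case True
    then have "dist (g s) l < 1" using d(2) s by simp
    then show ?thesis unfolding dist_real_def by linarith
  next
    case False
    then show ?thesis using B[of s] s by auto
  qed
  then show ?thesis by blast
qed

section \<open>Bihari growth estimate\<close>

text \<open>
  Monotone convergence along \<open>[\<xi>, \<xi> + n]\<close>.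
\<close>

lemma improper_integral_unbounded:
  fixes g :: "real \<Rightarrow> real"
  assumes cont: "continuous_on {\<xi>..} g" and nn: "\<And>s. s \<ge> \<xi> \<Longrightarrow> g s \<ge> 0"
    and div: "(\<integral>\<^sup>+ s\<in>{\<xi>..}. ennreal (g s) \<partial>lborel) = \<infinity>"
  shows "\<exists>y\<ge>\<xi>. integral {\<xi>..y} g > B"
proof (rule ccontr)
  assume "\<not> ?thesis"
  then have le: "integral {\<xi>..y} g \<le> B" if "y \<ge> \<xi>" for y using that by force
  define G where "G s = (if s \<ge> \<xi> then g s else 0)" for s
  have piece: "(\<integral>\<^sup>+ s. ennreal (indicator {\<xi>..\<xi> + real n} s * G s) \<partial>lborel) \<le> ennreal B" for n
  proof -
    have "continuous_on {\<xi>..\<xi> + real n} g" using cont by (rule continuous_on_subset) auto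
    then have "(g has_integral integral {\<xi>..\<xi> + real n} g) {\<xi>..\<xi> + real n}"
      by (intro integrable_integral integrable_continuous_interval)
    then have "(G has_integral integral {\<xi>..\<xi> + real n} g) {\<xi>..\<xi> + real n}"
      by (rule has_integral_eq[rotated]) (simp add: G_def)
    moreover have "0 \<le> G s" for s using nn by (simp add: G_def)
    ultimately have "(\<integral>\<^sup>+ s. ennreal (indicator {\<xi>..\<xi> + real n} s * G s) \<partial>lborel) = ennreal (integral {\<xi>..\<xi> + real n} g)"
      by (intro nn_integral_has_integral_lebesgue)
    then show ?thesis using le[of "\<xi> + real n"] by (simp add: ennreal_leI)
  qed
  have Gm: "G \<in> borel_measurable borel"
    unfolding G_def using cont
    by (intro borel_measurable_continuous_on_if[where A="{\<xi>..}", unfolded atLeast_iff]) auto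
  have mono: "incseq (\<lambda>n s. ennreal (indicator {\<xi>..\<xi> + real n} s * G s))"
    using nn by (auto simp: incseq_def le_fun_def G_def indicator_def intro!: ennreal_leI)
  have "(\<integral>\<^sup>+ s\<in>{\<xi>..}. ennreal (g s) \<partial>lborel) = (\<integral>\<^sup>+ s. (SUP n. ennreal (indicator {\<xi>..\<xi> + real n} s * G s)) \<partial>lborel)"
  proof (rule nn_integral_cong)
    fix s :: real
    obtain n :: nat where n: "s - \<xi> \<le> real n" using real_arch_simple by blast
    show "ennreal (g s) * indicator {\<xi>..} s = (SUP n. ennreal (indicator {\<xi>..\<xi> + real n} s * G s))"
    proof (rule antisym)
      have "ennreal (g s) * indicator {\<xi>..} s \<le> ennreal (indicator {\<xi>..\<xi> + real n} s * G s)"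
        using n by (auto simp: G_def indicator_def)
      also have "\<dots> \<le> (SUP n. ennreal (indicator {\<xi>..\<xi> + real n} s * G s))" by (intro SUP_upper) auto
      finally show "ennreal (g s) * indicator {\<xi>..} s \<le> (SUP n. ennreal (indicator {\<xi>..\<xi> + real n} s * G s))" .
      show "(SUP n. ennreal (indicator {\<xi>..\<xi> + real n} s * G s)) \<le> ennreal (g s) * indicator {\<xi>..} s"
        by (intro SUP_least) (auto simp: G_def indicator_def)
    qed
  qed
  also have "\<dots> = (SUP n. \<integral>\<^sup>+ s. ennreal (indicator {\<xi>..\<xi> + real n} s * G s) \<partial>lborel)"
    using Gm by (intro nn_integral_monotone_convergence_SUP mono) simp
  also have "\<dots> \<le> ennreal B" by (intro SUP_least piece)
  finally show False using div by (simp add: top_unique)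
qed

text \<open>
  The right-hand side \<open>V\<close> of the integral inequality is differentiable with
  \<open>V' = k * \<Theta>(Z) \<le> k * \<Theta>(V)\<close>, so for the primitive \<open>G\<close> of \<open>1/\<Theta>\<close> the function \<open>G(V)\<close> grows by at most
  the integral of \<open>k\<close>. As \<open>G\<close> is unbounded, \<open>V\<close> stays bounded.
\<close>

lemma Bihari_bounded:
  fixes k \<Theta> Z :: "real \<Rightarrow> real"
  assumes k: "continuous_on {0..} k" "\<And>t. t \<ge> 0 \<Longrightarrow> k t \<ge> 0" "\<And>T. T \<ge> 0 \<Longrightarrow> integral {0..T} k \<le> A"
    and \<Theta>: "continuous_on {\<xi>..} \<Theta>" "mono_on {\<xi>..} \<Theta>" "\<And>s. s \<ge> \<xi> \<Longrightarrow> \<Theta> s > 0"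
    and div: "(\<integral>\<^sup>+ s\<in>{\<xi>..}. ennreal (1 / \<Theta> s) \<partial>lborel) = \<infinity>"
    and Z: "continuous_on {0..} Z" "\<And>t. t \<ge> 0 \<Longrightarrow> \<xi> \<le> Z t" and c: "\<xi> \<le> c"
    and le: "\<And>t. t \<ge> 0 \<Longrightarrow> Z t \<le> c + integral {0..t} (\<lambda>s. k s * \<Theta> (Z s))"
  shows "\<exists>R. \<forall>t\<ge>0. Z t \<le> R"
proof -
  define V where "V t = c + integral {0..t} (\<lambda>s. k s * \<Theta> (Z s))" for t
  define G where "G y = integral {\<xi>..y} (\<lambda>s. 1 / \<Theta> s)" for y
  have kZ: "continuous_on {0..} (\<lambda>s. k s * \<Theta> (Z s))"
    using Z by (intro continuous_on_mult k(1) continuous_on_compose2[OF \<Theta>(1)]) auto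
  have kZnn: "0 \<le> k s * \<Theta> (Z s)" if "s \<ge> 0" for s
    using k(2)[OF that] \<Theta>(3)[OF Z(2)[OF that]] by simp
  have cont\<Theta>: "continuous_on {\<xi>..} (\<lambda>s. 1 / \<Theta> s)"
    using \<Theta> by (intro continuous_intros) (metis atLeast_iff less_irrefl)+
  have Vmono: "V s \<le> V t" if "0 \<le> s" "s \<le> t" for s t
  proof -
    have "(\<lambda>s. k s * \<Theta> (Z s)) integrable_on {0..r}" for r
      by (rule integrable_continuous_interval, rule continuous_on_subset[OF kZ]) auto
    then show ?thesis unfolding V_def using that kZnn by (auto intro!: integral_subset_le)
  qed
  have Vc: "c \<le> V t" if "0 \<le> t" for t using Vmono[of 0 t] that by (simp add: V_def)
  have bound: "G (V T) \<le> G c + A" if T: "0 \<le> T" for T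
  proof -
    have d1: "((\<lambda>t. G (V t)) has_real_derivative (1 / \<Theta> (V t)) * (k t * \<Theta> (Z t))) (at t within {0..T})"
      if t: "t \<in> {0..T}" for t
    proof -
      have "((\<lambda>u. integral {0..u} (\<lambda>s. k s * \<Theta> (Z s))) has_real_derivative k t * \<Theta> (Z t)) (at t within {0..T})"
        by (rule integral_has_real_derivative[OF continuous_on_subset[OF kZ] t]) auto
      then have V': "(V has_real_derivative k t * \<Theta> (Z t)) (at t within {0..T})"
        using DERIV_add[OF DERIV_const[of c]] unfolding V_def by fastforce
      have Vin: "V ` {0..T} \<subseteq> {\<xi>..V T}" using Vmono Vc c by (force intro: order_trans)
      have "(G has_real_derivative 1 / \<Theta> (V t)) (at (V t) within {\<xi>..V T})"
        unfolding G_def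
        by (rule integral_has_real_derivative[OF continuous_on_subset[OF cont\<Theta>]]) (use subsetD[OF Vin imageI[OF t]] in auto)
      then have "(G has_real_derivative 1 / \<Theta> (V t)) (at (V t) within V ` {0..T})"
        by (rule DERIV_subset[OF _ Vin])
      from DERIV_image_chain[OF this V'] show ?thesis by (simp add: o_def)
    qed
    have "((\<lambda>t. (1 / \<Theta> (V t)) * (k t * \<Theta> (Z t))) has_integral (G (V T) - G (V 0))) {0..T}"
      using T d1 by (intro fundamental_theorem_of_calculus)
        (auto simp: has_real_derivative_iff_has_vector_derivative[symmetric])
    moreover have "(k has_integral integral {0..T} k) {0..T}"
      by (intro integrable_integral integrable_continuous_interval continuous_on_subset[OF k(1)]) auto
    moreover have "(1 / \<Theta> (V t)) * (k t * \<Theta> (Z t)) \<le> k t" if "t \<in> {0..T}" for t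
    proof -
      have t: "0 \<le> t" using that by simp
      have "\<Theta> (Z t) \<le> \<Theta> (V t)"
        using le[OF t] Z(2)[OF t] by (intro mono_onD[OF \<Theta>(2)]) (auto simp: V_def)
      moreover have "\<Theta> (V t) > 0" using Vc[OF t] c by (intro \<Theta>(3)) linarith
      ultimately show ?thesis
        using mult_left_mono[OF _ k(2)[OF t], of "\<Theta> (Z t)" "\<Theta> (V t)"] by (simp add: field_simps)
    qed
    ultimately have "G (V T) - G (V 0) \<le> integral {0..T} k" by (rule has_integral_le)
    then show ?thesis using k(3)[OF T] by (simp add: V_def)
  qed
  obtain y where y: "y \<ge> \<xi>" "G y > G c + A"
    using improper_integral_unbounded[OF cont\<Theta> _ div, of "G c + A"] \<Theta>(3) unfolding G_def
    by (meson divide_nonneg_pos zero_le_one)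
  have "V t \<le> y" if t: "0 \<le> t" for t
  proof (rule ccontr)
    assume "\<not> V t \<le> y"
    then have "G y \<le> G (V t)"
      unfolding G_def using \<Theta>(3)
      by (intro integral_subset_le integrable_continuous_interval continuous_on_subset[OF cont\<Theta>]) (auto intro: less_imp_le)
    then show False using bound[OF t] y(2) by simp
  qed
  then show ?thesis using le unfolding V_def by (meson order_trans)
qed

text \<open>
  Monotone functions are Borel measurable, which makes the integrand measurable even where \<open>w\<close>
  is discontinuous; on \<open>[0,T]\<close> it is bounded because \<open>\<Psi> (w s) \<le> \<Psi> (w T)\<close>.
\<close>

lemma weight_integrable:
  fixes h \<Psi> w :: "real \<Rightarrow> real"
  assumes h: "continuous_on {0..} h" "\<And>s. 0 \<le> s \<Longrightarrow> 0 \<le> h s"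
    and \<Psi>: "mono_on {0..} \<Psi>" "\<And>s. 0 \<le> s \<Longrightarrow> 0 \<le> \<Psi> s"
    and w: "mono w" "\<And>s. 0 \<le> w s" and q: "0 < q"
  shows "(\<lambda>s. indicator {0..T} s * (h s * \<Psi> (w s))) \<in> borel_measurable lborel"
    and "integrable lborel (\<lambda>s. indicator {0..T} s * (h s * \<Psi> (w s)) powr q)"
proof -
  have hT: "continuous_on {0..T} h" using h(1) by (rule continuous_on_subset) auto
  have hm: "(\<lambda>s. indicator {0..T} s *\<^sub>R h s) \<in> borel_measurable borel"
    by (rule borel_measurable_continuous_on_indicator[OF _ hT]) simp
  have "mono (\<lambda>s. \<Psi> (w s))"
    using w by (intro monoI mono_onD[OF \<Psi>(1)]) (auto dest: monoD)
  then have \<Psi>m: "(\<lambda>s. \<Psi> (w s)) \<in> borel_measurable borel" by (rule borel_measurable_mono)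
  have "(\<lambda>s. (indicator {0..T} s *\<^sub>R h s) * \<Psi> (w s)) \<in> borel_measurable borel"
    using hm \<Psi>m by (rule borel_measurable_times)
  then show m: "(\<lambda>s. indicator {0..T} s * (h s * \<Psi> (w s))) \<in> borel_measurable lborel"
    by (simp add: mult.assoc)
  have eq: "indicator {0..T} s * (h s * \<Psi> (w s)) powr q = (indicator {0..T} s * (h s * \<Psi> (w s))) powr q" for s
    by (simp add: indicator_def)
  obtain B where B: "\<And>s. s \<in> {0..T} \<Longrightarrow> h s \<le> B"
    using compact_imp_bounded[OF compact_continuous_image[OF hT compact_Icc]] unfolding bounded_iff
    by (metis (no_types, opaque_lifting) abs_ge_self image_eqI order_trans real_norm_def)
  show "integrable lborel (\<lambda>s. indicator {0..T} s * (h s * \<Psi> (w s)) powr q)"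
  proof (rule Bochner_Integration.integrable_bound)
    show "integrable lborel (\<lambda>s. indicator {0..T} s *\<^sub>R (B * \<Psi> (w T)) powr q)"
      by (intro integrable_scaleR_left integrable_real_indicator) (auto simp: emeasure_lborel_Icc_eq)
    show "(\<lambda>s. indicator {0..T} s * (h s * \<Psi> (w s)) powr q) \<in> borel_measurable lborel"
      unfolding eq using m by measurable
    have "(h s * \<Psi> (w s)) powr q \<le> (B * \<Psi> (w T)) powr q" if s: "s \<in> {0..T}" for s
    proof (rule powr_mono2)
      have hs: "0 \<le> h s" using h(2) s by auto
      show "h s * \<Psi> (w s) \<le> B * \<Psi> (w T)"
      proof (rule mult_mono)
        show "\<Psi> (w s) \<le> \<Psi> (w T)" using w s by (intro mono_onD[OF \<Psi>(1)]) (auto dest: monoD)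
        show "0 \<le> B" using hs B[OF s] by linarith
      qed (use B[OF s] \<Psi>(2)[OF w(2)] in auto)
      show "0 \<le> h s * \<Psi> (w s)" using hs \<Psi>(2)[OF w(2)] by simp
    qed (use q in auto)
    then show "AE s in lborel. norm (indicator {0..T} s * (h s * \<Psi> (w s)) powr q) \<le> norm (indicator {0..T} s *\<^sub>R (B * \<Psi> (w T)) powr q)"
      by (intro AE_I2) (auto simp: indicator_def)
  qed
qed


lemma continuous_on_halflineI:
  fixes f :: "real \<Rightarrow> real"
  assumes "\<And>T. 0 \<le> T \<Longrightarrow> continuous_on {0..T} f"
  shows "continuous_on {0..} f"
  unfolding continuous_on_eq_continuous_within
proof
  fix t :: real assume t: "t \<in> {0..}"
  have "at t within {0..} = at t within {0..t + 1}"
    by (rule at_within_nhd[of t "{..<t+1}"]) auto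
  moreover have "continuous (at t within {0..t + 1}) f"
    using assms[of "t + 1"] t by (auto simp: continuous_on_eq_continuous_within)
  ultimately show "continuous (at t within {0..}) f" by simp
qed

text \<open>
  The hypothesis \<open>est\<close> is only available for monotone majorants \<open>w\<close> of \<open>A\<close>, so it is applied to the
  least one, the running supremum of \<open>A\<close>. Being monotone, the right-hand side of \<open>est\<close> then bounds
  \<open>w\<close> itself. A continuous majorant \<open>Z\<close> of \<open>w powr q\<close>, an affine function of the integral of the
  weight, satisfies the inequality of \<open>Bihari_bounded\<close>.
\<close>

lemma weighted_growth_bounded:
  fixes A h \<Psi> :: "real \<Rightarrow> real"
  assumes q: "q > 1" and \<xi>: "0 < \<xi>"
    and h: "continuous_on {0..} h" "\<And>s. 0 \<le> s \<Longrightarrow> 0 \<le> h s"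
    and h_Lq: "(\<lambda>s. h s powr q) integrable_on {0<..}"
    and \<Psi>: "continuous_on {0..} \<Psi>" "mono_on {0..} \<Psi>" "\<And>s. 0 \<le> s \<Longrightarrow> 0 \<le> \<Psi> s"
    and pos: "\<And>s. \<xi> \<le> s \<Longrightarrow> 0 < \<Psi> (s powr (1 / q))"
    and div: "(\<integral>\<^sup>+ s\<in>{\<xi>..}. ennreal (1 / \<Psi> (s powr (1 / q)) powr q) \<partial>lborel) = \<infinity>"
    and A_nn: "\<And>s. 0 < s \<Longrightarrow> 0 \<le> A s"
    and A_loc: "\<And>T. 0 < T \<Longrightarrow> \<exists>B. \<forall>s\<in>{0<..T}. A s \<le> B"
    and MK: "0 \<le> M" "0 \<le> K"
    and est: "\<And>\<tau> w. 0 < \<tau> \<Longrightarrow> mono w \<Longrightarrow> (\<And>s. 0 \<le> w s) \<Longrightarrow> (\<And>s. 0 < s \<Longrightarrow> A s \<le> w s) \<Longrightarrow>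
        A \<tau> \<le> M + K * (\<integral>s. indicator {0..\<tau>} s * (h s * \<Psi> (w s)) powr q \<partial>lborel) powr (1 / q)"
  shows "\<exists>C. \<forall>\<tau>>0. A \<tau> \<le> C"
proof -
  define w where "w s = (if s \<le> 0 then 0 else Sup (A ` {0<..s}))" for s
  have bdd: "bdd_above (A ` {0<..s})" if s: "0 < s" for s
  proof -
    obtain B where "\<forall>t\<in>{0<..s}. A t \<le> B" using A_loc[OF s] by blast
    then show ?thesis by (intro bdd_aboveI2) blast
  qed
  have Aw: "A s \<le> w s'" if "0 < s" "s \<le> s'" for s s'
    using that bdd[of s'] by (auto simp: w_def intro!: cSup_upper)
  have w_nn: "0 \<le> w s" for s
    using Aw[of s s] A_nn[of s] by (cases "s \<le> 0") (auto simp: w_def)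
  have w_mono: "mono w"
  proof (rule monoI)
    fix s t :: real assume st: "s \<le> t"
    show "w s \<le> w t"
    proof (cases "s \<le> 0")
      case True then show ?thesis using w_nn[of t] by (simp add: w_def)
    next
      case False
      then have "w s = Sup (A ` {0<..s})" by (simp add: w_def)
      also have "\<dots> \<le> w t" using False st Aw by (intro cSup_least) auto
      finally show ?thesis .
    qed
  qed
  define F where "F s = (h s * \<Psi> (w s)) powr q" for s
  define H where "H \<tau> = (\<integral>s. indicator {0..\<tau>} s * F s \<partial>lborel)" for \<tau>
  have q0: "0 < q" using q by simp
  note W = weight_integrable[OF h \<Psi>(2,3) w_mono w_nn q0, folded F_def]
  have F_si: "set_integrable lborel {0..\<tau>} F" for \<tau>
    using W(2)[of \<tau>] by (simp add: set_integrable_def)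
  have F_int: "F integrable_on {0..\<tau>}" and H_eq: "H \<tau> = integral {0..\<tau>} F" for \<tau>
    using set_borel_integral_eq_integral[OF F_si[of \<tau>]] by (simp_all add: H_def set_lebesgue_integral_def)
  have F_nn: "0 \<le> F s" for s by (simp add: F_def)
  have H_nn: "0 \<le> H \<tau>" for \<tau> unfolding H_eq using F_nn by (intro integral_nonneg F_int) auto
  have H_mono: "H s \<le> H t" if "s \<le> t" for s t
    unfolding H_eq using that F_nn by (intro integral_subset_le F_int) auto
  have wH: "w \<tau> \<le> M + K * H \<tau> powr (1 / q)" if \<tau>: "0 < \<tau>" for \<tau>
  proof -
    have "w \<tau> = Sup (A ` {0<..\<tau>})" using \<tau> by (simp add: w_def)
    also have "\<dots> \<le> M + K * H \<tau> powr (1 / q)"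
    proof (rule cSup_least)
      fix z assume "z \<in> A ` {0<..\<tau>}"
      then obtain s where s: "0 < s" "s \<le> \<tau>" "z = A s" by auto
      have "A s \<le> M + K * H s powr (1 / q)"
        using est[OF s(1) w_mono w_nn] Aw by (simp add: H_def F_def)
      also have "\<dots> \<le> M + K * H \<tau> powr (1 / q)"
        using H_nn H_mono[OF s(2)] MK q by (intro add_left_mono mult_left_mono powr_mono2) auto
      finally show "z \<le> M + K * H \<tau> powr (1 / q)" using s(3) by simp
    qed (use \<tau> in auto)
    finally show ?thesis .
  qed
  \<comment> \<open>\<open>M + K * H powr (1/q) \<le> (M + K) * (1 + H) powr (1/q)\<close>, whence \<open>w powr q \<le> L * (1 + H) \<le> Z\<close>. Adding
    \<open>\<xi>\<close> keeps \<open>Z\<close> in the range where \<open>\<Theta>\<close> is positive.\<close>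
  define L where "L = (M + K) powr q"
  define c where "c = L + \<xi>"
  define Z where "Z \<tau> = c + L * H \<tau>" for \<tau>
  have L: "0 \<le> L" by (simp add: L_def)
  have Z\<xi>: "\<xi> \<le> Z \<tau>" for \<tau> using L H_nn[of \<tau>] by (simp add: Z_def c_def)
  have wZ: "w \<tau> \<le> Z \<tau> powr (1 / q)" for \<tau>
  proof (cases "0 < \<tau>")
    case True
    have "M + K * H \<tau> powr (1 / q) \<le> M * (1 + H \<tau>) powr (1 / q) + K * (1 + H \<tau>) powr (1 / q)"
    proof (intro add_mono mult_left_mono powr_mono2)
      have "1 \<le> (1 + H \<tau>) powr (1 / q)" using H_nn[of \<tau>] q by (intro ge_one_powr_ge_zero) auto
      then show "M \<le> M * (1 + H \<tau>) powr (1 / q)" using MK mult_left_mono[of 1 _ M] by simp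
    qed (use H_nn q MK in auto)
    also have "\<dots> = (M + K) * (1 + H \<tau>) powr (1 / q)" by (simp add: distrib_right)
    also have "\<dots> = (L * (1 + H \<tau>)) powr (1 / q)"
      using MK q H_nn[of \<tau>] by (simp add: L_def powr_mult powr_powr)
    also have "\<dots> \<le> Z \<tau> powr (1 / q)"
      using L H_nn[of \<tau>] \<xi> q by (intro powr_mono2) (auto simp: Z_def c_def algebra_simps)
    finally show ?thesis using wH[OF True] by linarith
  qed (simp add: w_def)
  define \<Theta> where "\<Theta> s = \<Psi> (s powr (1 / q)) powr q" for s
  define k where "k s = L * h s powr q" for s
  have hq: "continuous_on {0..} (\<lambda>s. h s powr q)"
    using h q by (intro continuous_on_powr') (auto intro!: continuous_intros)
  have Z_cont: "continuous_on {0..} Z"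
    unfolding Z_def H_eq
    by (intro continuous_intros continuous_on_halflineI indefinite_integral_continuous_1 F_int)
  have \<Theta>_cont: "continuous_on {\<xi>..} \<Theta>"
  proof -
    have "continuous_on {\<xi>..} (\<lambda>s. \<Psi> (s powr (1 / q)))"
      using \<xi> by (intro continuous_on_compose2[OF \<Psi>(1)] continuous_intros) auto
    then show ?thesis unfolding \<Theta>_def using pos
      by (intro continuous_on_powr continuous_intros) (auto simp: less_imp_neq[symmetric])
  qed
  have \<Theta>_mono: "mono_on {\<xi>..} \<Theta>"
  proof (rule mono_onI)
    fix s t assume "s \<in> {\<xi>..}" "t \<in> {\<xi>..}" "s \<le> t"
    then show "\<Theta> s \<le> \<Theta> t"
      unfolding \<Theta>_def using \<xi> q \<Psi>(3)
      by (intro powr_mono2 mono_onD[OF \<Psi>(2)]) (auto intro!: powr_mono2)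
  qed
  have k_bound: "integral {0..T} k \<le> L * integral {0<..} (\<lambda>s. h s powr q)" if "0 \<le> T" for T
  proof -
    have "(\<lambda>s. h s powr q) integrable_on {0..T}"
      by (rule integrable_continuous_interval, rule continuous_on_subset[OF hq]) auto
    then have "(\<lambda>s. h s powr q) integrable_on {0<..<T}"
      by (simp add: integrable_on_open_interval_real)
    then have "integral {0<..<T} (\<lambda>s. h s powr q) \<le> integral {0<..} (\<lambda>s. h s powr q)"
      by (intro integral_subset_le h_Lq) auto
    then have "integral {0..T} (\<lambda>s. h s powr q) \<le> integral {0<..} (\<lambda>s. h s powr q)"
      by (simp add: integral_open_interval_real)
    then show ?thesis unfolding k_def using L by (simp add: mult_left_mono)
  qed
  have "\<exists>R. \<forall>t\<ge>0. Z t \<le> R"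
  proof (rule Bihari_bounded)
    show k_cont: "continuous_on {0..} k" unfolding k_def by (intro continuous_intros hq)
    show "0 \<le> k t" for t using L by (simp add: k_def)
    show "0 < \<Theta> s" if "\<xi> \<le> s" for s using pos[OF that] by (simp add: \<Theta>_def)
    show "(\<integral>\<^sup>+ s\<in>{\<xi>..}. ennreal (1 / \<Theta> s) \<partial>lborel) = \<infinity>" using div by (simp add: \<Theta>_def)
    show "\<xi> \<le> c" using L by (simp add: c_def)
    fix t :: real assume t: "0 \<le> t"
    have "L * H t = integral {0..t} (\<lambda>s. L * F s)" by (simp add: H_eq)
    also have "\<dots> \<le> integral {0..t} (\<lambda>s. k s * \<Theta> (Z s))"
    proof (rule integral_le)
      show "(\<lambda>s. L * F s) integrable_on {0..t}" by (intro integrable_on_mult_right F_int)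
      have "continuous_on {0..} (\<lambda>s. k s * \<Theta> (Z s))"
        using Z\<xi> by (intro continuous_intros k_cont continuous_on_compose2[OF \<Theta>_cont Z_cont]) auto
      then show "(\<lambda>s. k s * \<Theta> (Z s)) integrable_on {0..t}"
        by (intro integrable_continuous_interval) (auto elim: continuous_on_subset)
      fix s assume s: "s \<in> {0..t}"
      have "\<Psi> (w s) \<le> \<Psi> (Z s powr (1 / q))"
        using w_nn wZ by (intro mono_onD[OF \<Psi>(2)]) auto
      then have "F s \<le> (h s * \<Psi> (Z s powr (1 / q))) powr q"
        unfolding F_def using s h(2) \<Psi>(3) w_nn q by (intro powr_mono2 mult_left_mono mult_nonneg_nonneg) auto
      also have "\<dots> = h s powr q * \<Theta> (Z s)"
        using s h(2) \<Psi>(3) by (simp add: \<Theta>_def powr_mult)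
      finally show "L * F s \<le> k s * \<Theta> (Z s)"
        using L by (simp add: k_def mult.assoc mult_left_mono)
    qed
    finally show "Z t \<le> c + integral {0..t} (\<lambda>s. k s * \<Theta> (Z s))" by (simp add: Z_def)
  qed (use k_bound \<Theta>_cont \<Theta>_mono Z_cont Z\<xi> in auto)
  then obtain R where R: "\<And>t. 0 \<le> t \<Longrightarrow> Z t \<le> R" by blast
  have "A \<tau> \<le> R powr (1 / q)" if "0 < \<tau>" for \<tau>
  proof -
    have "A \<tau> \<le> Z \<tau> powr (1 / q)" using Aw[of \<tau> \<tau>] wZ[of \<tau>] that by linarith
    also have "\<dots> \<le> R powr (1 / q)" using R[of \<tau>] Z\<xi>[of \<tau>] \<xi> q that by (intro powr_mono2) auto
    finally show ?thesis .
  qed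
  then show ?thesis by blast
qed

section \<open>Boundedness of solutions\<close>

theorem theorem6p2:
  fixes \<alpha> \<beta> \<gamma> b q \<xi>\<^sub>0 :: real
    and f :: "real \<Rightarrow> real \<Rightarrow> real \<Rightarrow> real"
    and h \<phi>\<^sub>1 \<phi>\<^sub>2 x :: "real \<Rightarrow> real"
  assumes orders: "0 \<le> \<beta>" "\<beta> < \<alpha>" "\<alpha> < 1"
    and f_cont: "\<And>v w. continuous_on {0..} v \<Longrightarrow> continuous_on {0..} w \<Longrightarrow>
                   continuous_on {0..} (\<lambda>\<tau>. f \<tau> (v \<tau>) (w \<tau>))"
    and f_bound: "\<And>\<tau> u v. \<tau> > 0 \<Longrightarrow>
                   \<bar>f \<tau> u v\<bar> \<le> \<tau> powr \<gamma> * h \<tau> * \<phi>\<^sub>1 \<bar>u\<bar> * \<phi>\<^sub>2 \<bar>v\<bar>"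
    and cont: "continuous_on {0..} h" "continuous_on {0..} \<phi>\<^sub>1" "continuous_on {0..} \<phi>\<^sub>2"
    and nonneg: "\<And>s. s \<ge> 0 \<Longrightarrow> h s \<ge> 0" "\<And>s. s \<ge> 0 \<Longrightarrow> \<phi>\<^sub>1 s \<ge> 0" "\<And>s. s \<ge> 0 \<Longrightarrow> \<phi>\<^sub>2 s \<ge> 0"
    and mono: "mono_on {0..} \<phi>\<^sub>1" "mono_on {0..} \<phi>\<^sub>2"
    and q: "q > 1 / (\<alpha> - \<beta>)"
    and h_Lq: "set_integrable lebesgue {0<..} (\<lambda>\<tau>. \<bar>h \<tau>\<bar> powr q)"
    and \<gamma>: "\<gamma> = 1 / q - \<alpha>"
    and \<xi>\<^sub>0: "\<xi>\<^sub>0 > 0"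
    and pos: "\<And>s. s \<ge> \<xi>\<^sub>0 \<Longrightarrow> \<phi>\<^sub>1 (s powr (1 / q)) * \<phi>\<^sub>2 (s powr (1 / q)) > 0"
    and divergent: "(\<integral>\<^sup>+ s\<in>{\<xi>\<^sub>0..}.
          ennreal (1 / (\<phi>\<^sub>1 (s powr (1 / q)) powr q * \<phi>\<^sub>2 (s powr (1 / q)) powr q)) \<partial>lebesgue) = \<infinity>"
    and x: "x \<in> C_frac \<alpha>"
    and equation: "\<And>\<tau>. \<tau> > 0 \<Longrightarrow> caputo \<alpha> x \<tau> = f \<tau> (x \<tau>) (caputo \<beta> x \<tau>)"
    and initial: "x 0 = b"
  shows "\<exists>C>0. \<forall>\<tau>>0. \<bar>x \<tau>\<bar> \<le> C \<and> \<bar>caputo \<beta> x \<tau>\<bar> < C"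
proof -
  define A where "A \<tau> = max \<bar>x \<tau>\<bar> \<bar>caputo \<beta> x \<tau>\<bar>" for \<tau>
  define \<Psi> where "\<Psi> s = \<phi>\<^sub>1 s * \<phi>\<^sub>2 s" for s
  define g where "g = caputo \<alpha> x"
  have \<alpha>0: "0 < \<alpha>" using orders by linarith
  have ab: "0 < \<alpha> - \<beta>" "\<alpha> - \<beta> < 1" using orders by auto
  have q1: "q > 1"
  proof -
    have "1 < 1 / (\<alpha> - \<beta>)" using ab by simp
    then show ?thesis using q by linarith
  qed
  have qinv: "1 / q < \<alpha> - \<beta>" using q ab q1 by (simp add: field_simps)
  then have qinv\<alpha>: "1 / q < \<alpha>" using orders by linarith
  have x_eq: "x \<tau> = b + RL_integral \<alpha> g \<tau>" if "0 < \<tau>" for \<tau>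
    using caputo_inversion[OF x \<alpha>0 orders(3) that] initial by (simp add: g_def)
  have caputo_eq: "caputo \<beta> x \<tau> = RL_integral (\<alpha> - \<beta>) g \<tau>" if "0 < \<tau>" "\<beta> \<noteq> 0" for \<tau>
    using caputo_lower_order[OF x _ orders(2,3) that(1)] that(2) orders(1) by (simp add: g_def)
  have A_loc: "\<exists>B. \<forall>s\<in>{0<..T}. A s \<le> B" if T: "0 < T" for T
  proof -
    have "g \<in> C_halfline_ext" using x by (simp add: C_frac_def g_def)
    then obtain G where G: "\<And>s. 0 < s \<Longrightarrow> s \<le> T \<Longrightarrow> \<bar>g s\<bar> \<le> G"
      using C_halfline_ext_locally_bounded[OF _ T] by (metis greaterThanAtMost_iff)
    obtain B1 where B1: "\<And>s. s \<in> {0<..T} \<Longrightarrow> \<bar>RL_integral \<alpha> g s\<bar> \<le> B1"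
      using RL_integral_locally_bounded[OF \<alpha>0 T, of g G] G by blast
    obtain B2 where B2: "\<And>s. s \<in> {0<..T} \<Longrightarrow> \<bar>RL_integral (\<alpha> - \<beta>) g s\<bar> \<le> B2"
      using RL_integral_locally_bounded[OF ab(1) T, of g G] G by blast
    have "A s \<le> \<bar>b\<bar> + \<bar>B1\<bar> + \<bar>B2\<bar>" if s: "s \<in> {0<..T}" for s
    proof -
      have 1: "\<bar>x s\<bar> \<le> \<bar>b\<bar> + \<bar>B1\<bar>" using x_eq[of s] B1[OF s] s by auto
      have "\<bar>caputo \<beta> x s\<bar> \<le> \<bar>b\<bar> + \<bar>B1\<bar> + \<bar>B2\<bar>"
      proof (cases "\<beta> = 0")
        case True
        then show ?thesis using 1 by (simp add: caputo_def)
      next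
        case False
        then show ?thesis using caputo_eq[of s] B2[OF s] s by auto
      qed
      then show ?thesis unfolding A_def using 1 by linarith
    qed
    then show ?thesis by blast
  qed
  obtain M0 where M0: "\<And>s. s \<in> {0<..1} \<Longrightarrow> A s \<le> M0" using A_loc[OF zero_less_one] by blast
  define K1 where "K1 = weighted_RL_norm q \<alpha> \<alpha>"
  define K2 where "K2 = weighted_RL_norm q \<alpha> (\<alpha> - \<beta>)"
  have K1_nn: "0 \<le> K1" and K2_nn: "0 \<le> K2"
    using \<alpha>0 ab(1) by (auto simp: K1_def K2_def intro: weighted_RL_norm_nonneg)
  have \<Psi>_mono: "mono_on {0..} \<Psi>"
  proof (rule mono_onI)
    fix r s :: real assume rs: "r \<in> {0..}" "s \<in> {0..}" "r \<le> s"
    then show "\<Psi> r \<le> \<Psi> s"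
      unfolding \<Psi>_def using nonneg(2)[of s] nonneg(3)[of r]
      by (intro mult_mono mono_onD[OF mono(1) rs] mono_onD[OF mono(2) rs]) auto
  qed
  have \<Psi>_nn: "0 \<le> \<Psi> s" if "0 \<le> s" for s using nonneg(2,3)[OF that] by (simp add: \<Psi>_def)
  have "\<exists>C. \<forall>\<tau>>0. A \<tau> \<le> C"
  proof (rule weighted_growth_bounded[where \<Psi>=\<Psi> and h=h and M="\<bar>b\<bar> + \<bar>M0\<bar>" and K="K1 + K2"])
    show "continuous_on {0..} \<Psi>" unfolding \<Psi>_def using cont by (intro continuous_intros)
    have "set_integrable lebesgue {0<..} (\<lambda>s. h s powr q)"
      using h_Lq nonneg(1) by (subst set_integrable_cong[OF refl, where f'="\<lambda>\<tau>. \<bar>h \<tau>\<bar> powr q"]) auto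
    then show "(\<lambda>s. h s powr q) integrable_on {0<..}" by (rule set_lebesgue_integral_eq_integral(1))
    show "0 < \<Psi> (s powr (1 / q))" if "\<xi>\<^sub>0 \<le> s" for s using pos[OF that] by (simp add: \<Psi>_def)
    have "(\<integral>\<^sup>+ s\<in>{\<xi>\<^sub>0..}. ennreal (1 / \<Psi> (s powr (1 / q)) powr q) \<partial>lborel) =
      (\<integral>\<^sup>+ s\<in>{\<xi>\<^sub>0..}. ennreal (1 / (\<phi>\<^sub>1 (s powr (1 / q)) powr q * \<phi>\<^sub>2 (s powr (1 / q)) powr q)) \<partial>lborel)"
      using nonneg(2,3) by (simp add: \<Psi>_def powr_mult)
    then show "(\<integral>\<^sup>+ s\<in>{\<xi>\<^sub>0..}. ennreal (1 / \<Psi> (s powr (1 / q)) powr q) \<partial>lborel) = \<infinity>"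
      using divergent by (simp add: nn_integral_completion)
    fix \<tau> :: real and w :: "real \<Rightarrow> real"
    assume \<tau>: "0 < \<tau>" and w: "mono w" "\<And>s. 0 \<le> w s" and Aw: "\<And>s. 0 < s \<Longrightarrow> A s \<le> w s"
    define I where "I = (\<integral>s. indicator {0..\<tau>} s * (h s * \<Psi> (w s)) powr q \<partial>lborel) powr (1 / q)"
    have I: "0 \<le> I" by (simp add: I_def)
    have v_nn: "0 \<le> h s * \<Psi> (w s)" if "0 \<le> s" for s using nonneg(1)[OF that] \<Psi>_nn[OF w(2)] by simp
    have q0: "0 < q" using q1 by simp
    note W = weight_integrable[OF cont(1) nonneg(1) \<Psi>_mono \<Psi>_nn w q0, of \<tau>]
    have g_le: "\<bar>g s\<bar> \<le> s powr (1 / q - \<alpha>) * (h s * \<Psi> (w s))" if s: "0 < s" for s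
    proof -
      have ws: "\<bar>x s\<bar> \<le> w s" "\<bar>caputo \<beta> x s\<bar> \<le> w s" using Aw[OF s] by (auto simp: A_def)
      have "\<bar>g s\<bar> \<le> s powr \<gamma> * h s * \<phi>\<^sub>1 \<bar>x s\<bar> * \<phi>\<^sub>2 \<bar>caputo \<beta> x s\<bar>"
        using f_bound[OF s, of "x s" "caputo \<beta> x s"] equation[OF s] by (simp add: g_def)
      also have "\<dots> \<le> s powr \<gamma> * h s * \<phi>\<^sub>1 (w s) * \<phi>\<^sub>2 (w s)"
        using ws nonneg s w(2)
        by (intro mult_mono mult_nonneg_nonneg order_refl mono_onD[OF mono(1)] mono_onD[OF mono(2)]) auto
      finally show ?thesis by (simp add: \<gamma> \<Psi>_def mult.assoc)
    qed
    have "\<bar>RL_integral \<alpha> g \<tau>\<bar> \<le> K1 * I"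
      using RL_integral_weighted_bound[OF q1 qinv\<alpha> orders(3) \<tau> W(1) v_nn W(2) g_le] \<tau> by (simp add: I_def K1_def)
    then have x_le: "\<bar>x \<tau>\<bar> \<le> \<bar>b\<bar> + K1 * I" using x_eq[OF \<tau>] by linarith
    have "A \<tau> \<le> \<bar>b\<bar> + \<bar>M0\<bar> + (K1 + K2) * I"
    \<comment> \<open>For small \<open>\<tau>\<close> the factor \<open>\<tau> powr (- \<beta>)\<close> is unbounded, and the local bound takes over.\<close>
    proof (cases "\<tau> \<le> 1")
      case True
      then have "A \<tau> \<le> M0" using M0 \<tau> by simp
      moreover have "0 \<le> (K1 + K2) * I" using K1_nn K2_nn I by simp
      ultimately show ?thesis by linarith
    next
      case False
      have K: "0 \<le> K1 * I" "0 \<le> K2 * I" using K1_nn K2_nn I by auto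
      have "\<bar>caputo \<beta> x \<tau>\<bar> \<le> \<bar>b\<bar> + K1 * I + K2 * I"
      proof (cases "\<beta> = 0")
        case True
        then show ?thesis using x_le K by (simp add: caputo_def)
      next
        case nz: False
        have "\<tau> powr (- \<beta>) \<le> 1"
          using False orders(1) ge_one_powr_ge_zero[of \<tau> \<beta>] by (simp add: powr_minus inverse_le_1_iff)
        then have "K2 * \<tau> powr (- \<beta>) * I \<le> K2 * 1 * I"
          using K2_nn I by (intro mult_right_mono mult_left_mono)
        moreover have "\<bar>RL_integral (\<alpha> - \<beta>) g \<tau>\<bar> \<le> K2 * \<tau> powr (- \<beta>) * I"
          using RL_integral_weighted_bound[OF q1 qinv orders(3) \<tau> W(1) v_nn W(2) g_le] by (simp add: I_def K2_def)
        ultimately show ?thesis using caputo_eq[OF \<tau> nz] K by simp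
      qed
      then show ?thesis unfolding A_def distrib_right using x_le K by linarith
    qed
    then show "A \<tau> \<le> \<bar>b\<bar> + \<bar>M0\<bar> + (K1 + K2) * (\<integral>s. indicator {0..\<tau>} s * (h s * \<Psi> (w s)) powr q \<partial>lborel) powr (1 / q)"
      by (simp add: I_def)
  qed (use q1 \<xi>\<^sub>0 cont nonneg \<Psi>_mono \<Psi>_nn A_loc K1_nn K2_nn in \<open>auto simp: A_def\<close>)
  then obtain C where C: "\<And>\<tau>. 0 < \<tau> \<Longrightarrow> A \<tau> \<le> C" by blast
  show ?thesis
  proof (intro exI conjI allI impI)
    \<comment> \<open>The increment by \<open>1\<close> makes the second inequality strict.\<close>
    show "0 < \<bar>C\<bar> + 1" by simp
    fix \<tau> :: real assume "0 < \<tau>"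
    from C[OF this] show "\<bar>x \<tau>\<bar> \<le> \<bar>C\<bar> + 1" "\<bar>caputo \<beta> x \<tau>\<bar> < \<bar>C\<bar> + 1"
      by (auto simp: A_def)
  qed
qed

end
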